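(* Let $A_1,A_2$ be Hermitian $n\times n$ complex matrices and let $X$ be any $n\times n$ complex matrix. Then $$s(A_1X-XA_2)\prec_w s(X)\,\mathrm{Spr}^+(A_1\oplus A_2),$$ where the right-hand side is the entrywise product $\big(s_i(X)\,\mathrm{Spr}^+_i(A_1\oplus A_2)\big)_{1\le i\le n}$.
   Context: For a Hermitian $m\times m$ complex matrix $A$, $\lambda(A)=(\lambda_1(A),\dots,\lambda_m(A))$ denotes its eigenvalues, counted with multiplicity, in non-increasing order. The spectral spread of $A$ is $\mathrm{Spr}^+(A)=(\lambda_i(A)-\lambda_{m-i+1}(A))_{1\le i\le [m/2]}\in\mathbb{R}_{\ge 0}^{[m/2]}$, where $[\cdot]$ is the integer part. $A_1\oplus A_2$ is the $2n\times 2n$ block diagonal matrix with diagonal blocks $A_1,A_2$; thus $\mathrm{Spr}^+(A_1\oplus A_2)\in\mathbb{R}^n_{\ge0}$. For an $n\times n$ complex matrix $C$, $s(C)=\lambda((C^*C)^{1/2})\in\mathbb{R}_{\ge0}^n$ is the vector of singular values in non-increasing order. Submajorization: for $x,y\in\mathbb{R}^n$, $x\prec_w y$ means $\sum_{i=1}^j x_i^{\downarrow}\le\sum_{i=1}^j y_i^{\downarrow}$ for all $1\le j\le n$, where $x^{\downarrow}$ is the non-increasing rearrangement of $x$. *)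

theory Defs
  imports "Jordan_Normal_Form.Schur_Decomposition" "HOL-Library.Multiset"
begin

definition hermitian :: "complex mat \<Rightarrow> bool" where
  "hermitian A \<longleftrightarrow> mat_adjoint A = A"

definition pos_semidef :: "complex mat \<Rightarrow> bool" where
  "pos_semidef A \<longleftrightarrow> hermitian A \<and>
     (\<forall>v \<in> carrier_vec (dim_row A). Re ((A *\<^sub>v v) \<bullet>c v) \<ge> 0)"

text \<open>For a positive semidefinite matrix, \<open>mat_sqrt A\<close> is its unique positive semidefinite
  square root.\<close>

definition mat_sqrt :: "complex mat \<Rightarrow> complex mat" where
  "mat_sqrt A = (THE B. B \<in> carrier_mat (dim_row A) (dim_row A) \<and> pos_semidef B \<and> B * B = A)"

text \<open>A vector in \<open>\<real>\<^sup>n\<close> is a list of length \<open>n\<close>, so the mathematical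
  index \<open>i\<close> is the list position \<open>i - 1\<close>.\<close>

definition decreasing :: "real list \<Rightarrow> real list" where
  "decreasing x = rev (sort x)"

text \<open>The roots of the characteristic polynomial with algebraic multiplicity, in non-increasing
  order. This is meant for Hermitian matrices only: their eigenvalues are real, so \<open>Re\<close>
  is just the conversion from complex to real numbers.\<close>

definition eigenvalue_list :: "complex mat \<Rightarrow> real list" where
  "eigenvalue_list A = rev (sorted_list_of_multiset (image_mset Re (proots (char_poly A))))"

definition singular_values :: "complex mat \<Rightarrow> real list" where
  "singular_values C = eigenvalue_list (mat_sqrt (mat_adjoint C * C))"

definition spectral_spread :: "complex mat \<Rightarrow> real list" where
  "spectral_spread A = (let m = dim_row A in
     map (\<lambda>k. eigenvalue_list A ! k - eigenvalue_list A ! (m - 1 - k)) [0..<m div 2])"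

definition direct_sum_mat :: "complex mat \<Rightarrow> complex mat \<Rightarrow> complex mat" where
  "direct_sum_mat A B = four_block_mat A (0\<^sub>m (dim_row A) (dim_col B))
                                       (0\<^sub>m (dim_row B) (dim_col A)) B"

definition submajorized :: "real list \<Rightarrow> real list \<Rightarrow> bool" (infix \<open>\<prec>\<^sub>w\<close> 50) where
  "x \<prec>\<^sub>w y \<longleftrightarrow> length x = length y \<and>
     (\<forall>j \<in> {1..length x}. (\<Sum>i<j. decreasing x ! i) \<le> (\<Sum>i<j. decreasing y ! i))"

end

theory Submission
  imports Defs
begin

text \<open>
  Let \<open>C = A\<^sub>1 X - X A\<^sub>2\<close>. The proof rests on a duality: the sum of the \<open>j\<close> largest singular values of \<open>C\<close> is
  \<open>tr (C W)\<close> for a contraction \<open>W\<close> of rank at most \<open>j\<close>, read off from a singular value decomposition of \<open>C\<close>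
  (\<open>singular_value_decomposition\<close>). By cyclicity of the trace,
  \<open>tr (C W) = tr (X (W A\<^sub>1 - A\<^sub>2 W))\<close>, which is linear in \<open>X\<close>.

  A singular value decomposition of \<open>X\<close> writes \<open>X\<close> as the sum of \<open>(s\<^sub>k - s\<^sub>k\<^sub>+\<^sub>1) P\<^sub>k\<close> with contractions \<open>P\<^sub>k\<close> of
  rank at most \<open>k\<close> and nonnegative coefficients. By summation by parts (\<open>sum_mono_partial_sums\<close>) it
  suffices to bound the real part of \<open>tr (P (W A\<^sub>1 - A\<^sub>2 W))\<close>, for \<open>P\<close> of rank at most \<open>k\<close>, by the sum of the
  first \<open>min j k\<close> entries of the spectral spread (\<open>trace_truncated_commutator_le_spread\<close>).

  That trace equals \<open>tr (A\<^sub>1 P W) - tr (A\<^sub>2 W P)\<close>. In eigenbases of \<open>A\<^sub>1\<close> and \<open>A\<^sub>2\<close> it becomes a weighted sum of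
  the \<open>2 n\<close> eigenvalues of \<open>A\<^sub>1 \<oplus> A\<^sub>2\<close>, the weights being diagonal entries of \<open>P W\<close> and of \<open>- W P\<close>. The
  weights have modulus at most \<open>1\<close>, they add up to \<open>0\<close> because \<open>P W\<close> and \<open>W P\<close> have equal traces, and their
  absolute values add up to at most \<open>2 min j k\<close>, since a contraction of rank at most \<open>r\<close> has trace norm at
  most \<open>r\<close> (\<open>sum_diag_truncated_le\<close>). Under these constraints the best weights are \<open>+1\<close> on the
  \<open>min j k\<close> largest and \<open>-1\<close> on the \<open>min j k\<close> smallest eigenvalues (\<open>balanced_weighted_sum_le\<close>), and this
  gives exactly the spectral spread.

  The remaining parts supply the matrix analysis behind this: the unitary diagonalisation of Hermitian
  matrices with eigenvalues in any prescribed order, the uniqueness of positive semidefinite square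
  roots, and the singular value decomposition.
\<close>

section \<open>Adjoint matrices\<close>

lemma mat_adjoint_dim [simp]:
  "dim_row (mat_adjoint A) = dim_col A" "dim_col (mat_adjoint A) = dim_row A"
  by (simp_all add: mat_adjoint_def)

lemma mat_adjoint_carrier [simp]:
  "A \<in> carrier_mat n m \<Longrightarrow> mat_adjoint A \<in> carrier_mat m n"
  by (intro carrier_matI) auto

lemma mat_adjoint_index [simp]:
  fixes A :: "complex mat"
  shows "i < dim_col A \<Longrightarrow> j < dim_row A \<Longrightarrow> mat_adjoint A $$ (i, j) = cnj (A $$ (j, i))"
  by (simp add: mat_adjoint_def mat_of_rows_def)

lemma mat_adjoint_adjoint [simp]: "mat_adjoint (mat_adjoint A) = (A :: complex mat)"
  by (rule eq_matI) auto

lemma mat_adjoint_mult: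
  fixes A B :: "complex mat"
  assumes "A \<in> carrier_mat n m" "B \<in> carrier_mat m k"
  shows "mat_adjoint (A * B) = mat_adjoint B * mat_adjoint A"
  using assms by (intro eq_matI) (auto simp: scalar_prod_def mult.commute)

lemma mat_adjoint_mat_diag [simp]:
  "mat_adjoint (mat_diag n f) = mat_diag n (\<lambda>i. cnj (f i))"
  by (intro eq_matI) (auto simp: mat_diag_def)

section \<open>Contractions\<close>

definition sqnorm :: "complex vec \<Rightarrow> real" where
  "sqnorm v = (\<Sum>i<dim_vec v. (cmod (v $ i))\<^sup>2)"

lemma sqnorm_nonneg: "0 \<le> sqnorm v"
  by (simp add: sqnorm_def sum_nonneg)

lemma sqnorm_entry_le: "i < dim_vec v \<Longrightarrow> (cmod (v $ i))\<^sup>2 \<le> sqnorm v"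
  unfolding sqnorm_def by (rule member_le_sum) auto

lemma sqnorm_eq_0: "sqnorm v = 0 \<Longrightarrow> i < dim_vec v \<Longrightarrow> v $ i = 0"
  using sqnorm_entry_le[of i v] by simp

lemma sqnorm_unit_vec: "i < n \<Longrightarrow> sqnorm (unit_vec n i) = 1"
  by (simp add: sqnorm_def unit_vec_def if_distrib[of cmod] if_distrib[of "\<lambda>x. x\<^sup>2"] cong: if_cong)

lemma cscalar_prod_self: "v \<bullet>c v = complex_of_real (sqnorm v)"
  unfolding sqnorm_def scalar_prod_def
  by (auto simp: complex_norm_square lessThan_atLeast0 simp del: of_real_power intro!: sum.cong)

lemma cscalar_prod_adjoint:
  fixes A :: "complex mat"
  assumes "A \<in> carrier_mat n m" "v \<in> carrier_vec m" "w \<in> carrier_vec n"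
  shows "(A *\<^sub>v v) \<bullet>c w = v \<bullet>c (mat_adjoint A *\<^sub>v w)"
proof -
  have "(A *\<^sub>v v) \<bullet>c w = (\<Sum>i<n. \<Sum>j<m. A $$ (i, j) * v $ j * cnj (w $ i))"
    using assms by (auto simp: scalar_prod_def sum_distrib_right lessThan_atLeast0 intro!: sum.cong)
  also have "\<dots> = (\<Sum>j<m. \<Sum>i<n. A $$ (i, j) * v $ j * cnj (w $ i))"
    by (rule sum.swap)
  also have "\<dots> = v \<bullet>c (mat_adjoint A *\<^sub>v w)"
    using assms by (auto simp: scalar_prod_def sum_distrib_left lessThan_atLeast0 mult.commute mult.left_commute intro!: sum.cong)
  finally show ?thesis .
qed

lemma sqnorm_mult_mat_vec:
  assumes "A \<in> carrier_mat n m" "v \<in> carrier_vec m"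
  shows "complex_of_real (sqnorm (A *\<^sub>v v)) = v \<bullet>c ((mat_adjoint A * A) *\<^sub>v v)"
proof -
  have "(mat_adjoint A * A) *\<^sub>v v = mat_adjoint A *\<^sub>v (A *\<^sub>v v)"
    using assms by (intro assoc_mult_mat_vec) auto
  then show ?thesis
    using cscalar_prod_adjoint[of A n m v "A *\<^sub>v v"] assms by (simp add: cscalar_prod_self)
qed

text \<open>The arithmetic-geometric mean form of the Cauchy-Schwarz inequality. All estimates below are
  between quantities bounded by \<open>1\<close> or by each other, so this form, which avoids square roots,
  loses nothing.\<close>

lemma Re_cscalar_prod_le:
  assumes "dim_vec v = dim_vec w"
  shows "Re (v \<bullet>c w) \<le> (sqnorm v + sqnorm w) / 2"
proof -
  have "Re (a * cnj b) \<le> ((cmod a)\<^sup>2 + (cmod b)\<^sup>2) / 2" for a b :: complex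
  proof -
    have "Re (a * cnj b) \<le> cmod a * cmod b"
      using complex_Re_le_cmod[of "a * cnj b"] by (simp add: norm_mult)
    also have "\<dots> \<le> ((cmod a)\<^sup>2 + (cmod b)\<^sup>2) / 2"
      using sum_squares_bound[of "cmod a" "cmod b"] by simp
    finally show ?thesis .
  qed
  then have "(\<Sum>i<dim_vec v. Re (v $ i * cnj (w $ i)))
      \<le> (\<Sum>i<dim_vec v. ((cmod (v $ i))\<^sup>2 + (cmod (w $ i))\<^sup>2) / 2)"
    by (intro sum_mono)
  moreover have "Re (v \<bullet>c w) = (\<Sum>i<dim_vec v. Re (v $ i * cnj (w $ i)))"
    using assms by (simp add: scalar_prod_def lessThan_atLeast0 del: times_complex.sel)
  ultimately show ?thesis
    using assms by (simp add: sqnorm_def sum.distrib flip: sum_divide_distrib)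
qed

definition contraction :: "nat \<Rightarrow> complex mat \<Rightarrow> bool" where
  "contraction n M \<longleftrightarrow> M \<in> carrier_mat n n \<and>
     (\<forall>v \<in> carrier_vec n. sqnorm (M *\<^sub>v v) \<le> sqnorm v)"

lemma contraction_carrier: "contraction n M \<Longrightarrow> M \<in> carrier_mat n n"
  by (simp add: contraction_def)

lemma contraction_mult:
  assumes "contraction n M" "contraction n N"
  shows "contraction n (M * N)"
proof -
  have "sqnorm (M * N *\<^sub>v v) \<le> sqnorm v" if "v \<in> carrier_vec n" for v
  proof -
    have "sqnorm (M *\<^sub>v (N *\<^sub>v v)) \<le> sqnorm (N *\<^sub>v v)" "sqnorm (N *\<^sub>v v) \<le> sqnorm v"
      using assms that by (auto simp: contraction_def)
    moreover have "M * N *\<^sub>v v = M *\<^sub>v (N *\<^sub>v v)"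
      using assms that by (intro assoc_mult_mat_vec) (auto simp: contraction_def)
    ultimately show ?thesis by simp
  qed
  then show ?thesis using assms by (auto simp: contraction_def)
qed

text \<open>For \<open>u = M\<^sup>* w\<close> one has \<open>\<parallel>u\<parallel>\<^sup>2 = \<langle>M u, w\<rangle> \<le> (\<parallel>M u\<parallel>\<^sup>2 + \<parallel>w\<parallel>\<^sup>2) / 2 \<le> (\<parallel>u\<parallel>\<^sup>2 + \<parallel>w\<parallel>\<^sup>2) / 2\<close>, and the
  term \<open>\<parallel>u\<parallel>\<^sup>2 / 2\<close> can be moved to the left.\<close>

lemma contraction_adjoint:
  assumes "contraction n M"
  shows "contraction n (mat_adjoint M)"
proof -
  have M: "M \<in> carrier_mat n n" using assms by (rule contraction_carrier)
  have "sqnorm (mat_adjoint M *\<^sub>v w) \<le> sqnorm w" if w: "w \<in> carrier_vec n" for w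
  proof -
    define u where "u = mat_adjoint M *\<^sub>v w"
    have u: "u \<in> carrier_vec n"
      using mult_mat_vec_carrier[OF mat_adjoint_carrier[OF M] w] by (simp add: u_def)
    have "sqnorm u = Re ((M *\<^sub>v u) \<bullet>c w)"
      using cscalar_prod_adjoint[OF M u w] by (simp add: u_def[symmetric] cscalar_prod_self)
    also have "\<dots> \<le> (sqnorm (M *\<^sub>v u) + sqnorm w) / 2"
      using M u w by (intro Re_cscalar_prod_le) simp
    also have "sqnorm (M *\<^sub>v u) \<le> sqnorm u" using assms u by (simp add: contraction_def)
    finally show ?thesis by (simp add: u_def)
  qed
  then show ?thesis using M by (simp add: contraction_def)
qed

text \<open>This criterion covers unitary matrices, truncations, and also the partial isometries that occur
  in singular value decompositions, whose Gram matrix has only the entries \<open>0\<close> and \<open>1\<close>.\<close>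

lemma contraction_gramI:
  assumes M: "M \<in> carrier_mat n n"
    and gram: "mat_adjoint M * M = mat_diag n (\<lambda>i. complex_of_real (f i))"
    and f: "\<And>i. i < n \<Longrightarrow> f i \<le> 1"
  shows "contraction n M"
proof -
  have "sqnorm (M *\<^sub>v v) \<le> sqnorm v" if v: "v \<in> carrier_vec n" for v
  proof -
    have "complex_of_real (sqnorm (M *\<^sub>v v)) = v \<bullet>c (mat_diag n (\<lambda>i. complex_of_real (f i)) *\<^sub>v v)"
      using sqnorm_mult_mat_vec[OF M v] gram by simp
    also have "mat_diag n (\<lambda>i. complex_of_real (f i)) *\<^sub>v v = vec n (\<lambda>i. f i * v $ i)"
      using v by (intro eq_vecI) (auto simp: mat_diag_def scalar_prod_def if_distrib[of "\<lambda>x. x * _"] cong: if_cong)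
    also have "v \<bullet>c vec n (\<lambda>i. f i * v $ i) = complex_of_real (\<Sum>i<n. f i * (cmod (v $ i))\<^sup>2)"
      using v by (auto simp: scalar_prod_def lessThan_atLeast0 complex_norm_square simp del: of_real_power intro!: sum.cong)
    finally have "sqnorm (M *\<^sub>v v) = (\<Sum>i<n. f i * (cmod (v $ i))\<^sup>2)"
      by (simp only: of_real_eq_iff)
    also have "\<dots> \<le> (\<Sum>i<n. 1 * (cmod (v $ i))\<^sup>2)"
      using f by (intro sum_mono mult_right_mono) auto
    finally show ?thesis using v by (simp add: sqnorm_def)
  qed
  then show ?thesis using M by (simp add: contraction_def)
qed

lemma contraction_isometry:
  "M \<in> carrier_mat n n \<Longrightarrow> mat_adjoint M * M = 1\<^sub>m n \<Longrightarrow> contraction n M"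
  using contraction_gramI[of M n "\<lambda>_. 1"] by simp

lemma contraction_col:
  assumes "contraction n M" "j < n"
  shows "(\<Sum>i<n. (cmod (M $$ (i, j)))\<^sup>2) \<le> 1"
proof -
  have M: "M \<in> carrier_mat n n" using assms by (simp add: contraction_def)
  have "sqnorm (M *\<^sub>v unit_vec n j) \<le> sqnorm (unit_vec n j)"
    using assms by (simp add: contraction_def)
  moreover have "sqnorm (unit_vec n j) = 1"
    using assms(2) by (rule sqnorm_unit_vec)
  moreover have "M *\<^sub>v unit_vec n j = col M j"
    using M assms(2) by (intro eq_vecI) (auto)
  ultimately show ?thesis using M assms(2) by (simp add: sqnorm_def)
qed

lemma contraction_row:
  assumes "contraction n M" "i < n"
  shows "(\<Sum>j<n. (cmod (M $$ (i, j)))\<^sup>2) \<le> 1"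
  using contraction_col[OF contraction_adjoint[OF assms(1)] assms(2)] assms(2)
    contraction_carrier[OF assms(1)] by simp

lemma contraction_entry:
  assumes "contraction n M" "i < n" "j < n"
  shows "cmod (M $$ (i, j)) \<le> 1"
proof -
  have "(cmod (M $$ (i, j)))\<^sup>2 \<le> (\<Sum>i<n. (cmod (M $$ (i, j)))\<^sup>2)"
    using assms(2) by (intro member_le_sum) auto
  also have "\<dots> \<le> 1" using assms by (intro contraction_col)
  finally show ?thesis by (simp add: power_le_one_iff abs_square_le_1)
qed

text \<open>The orthogonal projection of \<open>\<complex>\<^sup>n\<close> onto its first \<open>k\<close> coordinates. A matrix \<open>R * truncation n k * S\<close>
  with contractions \<open>R\<close>, \<open>S\<close> stands for a contraction of rank at most \<open>k\<close>; in this form no notion of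
  rank is required.\<close>

definition truncation :: "nat \<Rightarrow> nat \<Rightarrow> complex mat" where
  "truncation n k = mat_diag n (\<lambda>i. if i < k then 1 else 0)"

lemma truncation_carrier [simp]: "truncation n k \<in> carrier_mat n n"
  by (simp add: truncation_def)

lemma truncation_adjoint [simp]: "mat_adjoint (truncation n k) = truncation n k"
  by (simp add: truncation_def if_distrib[of cnj] cong: if_cong)

lemma truncation_idem: "truncation n k * truncation n k = truncation n k"
  unfolding truncation_def mat_diag_diag by (rule arg_cong[where f = "mat_diag n"]) auto

lemma contraction_truncation: "contraction n (truncation n k)"
proof (rule contraction_gramI)
  show "mat_adjoint (truncation n k) * truncation n k
      = mat_diag n (\<lambda>i. complex_of_real (if i < k then 1 else 0))"
    unfolding truncation_adjoint truncation_idem unfolding truncation_def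
    by (rule arg_cong[where f = "mat_diag n"]) auto
qed auto

text \<open>A contraction of rank at most \<open>k\<close> has trace norm at most \<open>k\<close>, which also bounds the absolute sum of its
  diagonal in any orthonormal basis. Concretely, each of the \<open>k\<close> terms of the matrix product contributes
  \<open>\<Sum>\<^sub>i \<bar>R\<^sub>i\<^sub>b\<bar> \<bar>S\<^sub>b\<^sub>i\<bar>\<close>, which is at most \<open>1\<close> because the columns of \<open>R\<close> and the rows of \<open>S\<close> have norm at
  most \<open>1\<close>.\<close>

lemma sum_diag_truncated_le:
  assumes R: "contraction n R" and S: "contraction n S" and k: "k \<le> n"
  shows "(\<Sum>i<n. cmod ((R * truncation n k * S) $$ (i, i))) \<le> real k"
proof -
  have carr: "R \<in> carrier_mat n n" "S \<in> carrier_mat n n"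
    using R S by (simp_all add: contraction_def)
  have entry: "(R * truncation n k * S) $$ (i, i) = (\<Sum>b<k. R $$ (i, b) * S $$ (b, i))" if "i < n" for i
  proof -
    have "(R * truncation n k * S) $$ (i, i)
        = (\<Sum>b<n. if b < k then R $$ (i, b) * S $$ (b, i) else 0)"
      using that carr unfolding truncation_def mat_diag_mult_right[OF carr(1)]
      by (auto simp: scalar_prod_def lessThan_atLeast0 intro!: sum.cong)
    also have "\<dots> = (\<Sum>b<k. R $$ (i, b) * S $$ (b, i))"
      using k by (intro sum.mono_neutral_cong_right) auto
    finally show ?thesis .
  qed
  have "(\<Sum>i<n. cmod ((R * truncation n k * S) $$ (i, i)))
      \<le> (\<Sum>i<n. \<Sum>b<k. ((cmod (R $$ (i, b)))\<^sup>2 + (cmod (S $$ (b, i)))\<^sup>2) / 2)"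
  proof (rule sum_mono)
    fix i assume "i \<in> {..<n}"
    then have "cmod ((R * truncation n k * S) $$ (i, i)) \<le> (\<Sum>b<k. cmod (R $$ (i, b)) * cmod (S $$ (b, i)))"
      by (auto simp: entry norm_mult intro: order_trans[OF norm_sum])
    also have "\<dots> \<le> (\<Sum>b<k. ((cmod (R $$ (i, b)))\<^sup>2 + (cmod (S $$ (b, i)))\<^sup>2) / 2)"
    proof (rule sum_mono)
      fix b
      show "cmod (R $$ (i, b)) * cmod (S $$ (b, i)) \<le> ((cmod (R $$ (i, b)))\<^sup>2 + (cmod (S $$ (b, i)))\<^sup>2) / 2"
        using sum_squares_bound[of "cmod (R $$ (i, b))" "cmod (S $$ (b, i))"] by simp
    qed
    finally show "cmod ((R * truncation n k * S) $$ (i, i)) \<le> \<dots>" .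
  qed
  also have "\<dots> = (\<Sum>b<k. ((\<Sum>i<n. (cmod (R $$ (i, b)))\<^sup>2) + (\<Sum>i<n. (cmod (S $$ (b, i)))\<^sup>2)) / 2)"
    by (subst sum.swap) (simp add: sum.distrib flip: sum_divide_distrib)
  also have "\<dots> \<le> (\<Sum>b<k. (1 + 1) / 2)"
    using k by (intro sum_mono divide_right_mono add_mono contraction_col[OF R] contraction_row[OF S]) auto
  finally show ?thesis by simp
qed

section \<open>Spectral decomposition of Hermitian matrices\<close>

definition unitary :: "nat \<Rightarrow> complex mat \<Rightarrow> bool" where
  "unitary n U \<longleftrightarrow> U \<in> carrier_mat n n \<and> mat_adjoint U * U = 1\<^sub>m n \<and> U * mat_adjoint U = 1\<^sub>m n"

lemma unitary_carrier: "unitary n U \<Longrightarrow> U \<in> carrier_mat n n"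
  by (simp add: unitary_def)

lemma unitaryI:
  assumes "U \<in> carrier_mat n n" "mat_adjoint U * U = 1\<^sub>m n"
  shows "unitary n U"
  using assms mat_mult_left_right_inverse[of "mat_adjoint U" n U] by (simp add: unitary_def)

lemma contraction_unitary: "unitary n U \<Longrightarrow> contraction n U"
  by (auto simp: unitary_def intro: contraction_isometry)

lemma unitary_mult:
  assumes U: "unitary n U" and V: "unitary n V"
  shows "unitary n (U * V)"
proof (rule unitaryI)
  have c: "U \<in> carrier_mat n n" "V \<in> carrier_mat n n"
    using assms by (simp_all add: unitary_def)
  have c': "mat_adjoint U \<in> carrier_mat n n" "mat_adjoint V \<in> carrier_mat n n" using c by simp_all
  show "U * V \<in> carrier_mat n n" using c by simp
  have "mat_adjoint (U * V) * (U * V) = mat_adjoint V * mat_adjoint U * (U * V)"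
    using mat_adjoint_mult[OF c] by simp
  also have "\<dots> = mat_adjoint V * (mat_adjoint U * (U * V))"
    by (rule assoc_mult_mat[of _ n n _ n _ n]) (use c c' in auto)
  also have "mat_adjoint U * (U * V) = (mat_adjoint U * U) * V"
    by (rule assoc_mult_mat[of _ n n _ n _ n, symmetric]) (use c c' in auto)
  finally show "mat_adjoint (U * V) * (U * V) = 1\<^sub>m n"
    using U V c by (simp add: unitary_def)
qed

text \<open>Completing \<open>v\<close> to a basis, orthogonalising it and rescaling its vectors.\<close>

lemma unitary_first_column:
  assumes v: "v \<in> carrier_vec n" "v \<noteq> 0\<^sub>v n"
  obtains W c where "unitary n W" "col W 0 = c \<cdot>\<^sub>v v"
proof -
  interpret cof_vec_space n "TYPE(complex)" .
  define b where "b = basis_completion v"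
  define ws where "ws = gram_schmidt n b"
  have b: "span (set b) = carrier_vec n" "distinct b" "\<not> lin_dep (set b)"
    "set b \<subseteq> carrier_vec n" "hd b = v" "length b = n"
    using basis_completion[OF v] by (simp_all add: b_def)
  have n: "0 < n"
  proof (rule ccontr)
    assume "\<not> 0 < n"
    then have "v = 0\<^sub>v n" using v(1) by (intro eq_vecI) auto
    with v(2) show False by simp
  qed
  have ws: "set ws \<subseteq> carrier_vec n" "corthogonal ws" "length ws = n"
    using gram_schmidt_result[OF b(4,2,3) ws_def] b(6) by simp_all
  obtain vs where bv: "b = v # vs" using b(5,6) n by (cases b) auto
  have ws0: "ws ! 0 = v"
    using gram_schmidt_hd[OF v(1), of vs] ws(3) n unfolding bv[symmetric] ws_def[symmetric]
    by (cases ws) auto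
  have wsc: "ws ! i \<in> carrier_vec n" if "i < n" for i using ws that by auto
  define W0 where "W0 = mat_of_cols n ws"
  have W0: "W0 \<in> carrier_mat n n" using ws(3) unfolding W0_def by auto
  have colW0: "col W0 i = ws ! i" if "i < n" for i
    using that ws wsc unfolding W0_def by simp
  define d where "d i = sqnorm (ws ! i)" for i
  have d: "0 < d i" if "i < n" for i
  proof -
    have "ws ! i \<bullet>c ws ! i \<noteq> 0"
      using corthogonalD[OF ws(2), of i i] that ws(3) by simp
    then show ?thesis using sqnorm_nonneg[of "ws ! i"] by (simp add: cscalar_prod_self d_def)
  qed
  have gram: "mat_adjoint W0 * W0 = mat_diag n (\<lambda>i. complex_of_real (d i))"
  proof (rule eq_matI)
    fix i j
    assume "i < dim_row (mat_diag n (\<lambda>i. complex_of_real (d i)))" "j < dim_col (mat_diag n (\<lambda>i. complex_of_real (d i)))"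
    then have ij: "i < n" "j < n" by (simp_all add: mat_diag_def)
    have "(mat_adjoint W0 * W0) $$ (i, j) = col W0 j \<bullet>c col W0 i"
      using ij W0 by (auto simp: scalar_prod_def mult.commute intro!: sum.cong)
    also have "\<dots> = (if i = j then complex_of_real (d j) else 0)"
      using corthogonalD[OF ws(2), of j i] ij ws(3) by (auto simp: colW0 cscalar_prod_self d_def)
    finally show "(mat_adjoint W0 * W0) $$ (i, j) = mat_diag n (\<lambda>i. complex_of_real (d i)) $$ (i, j)"
      using ij by (simp add: mat_diag_def)
  qed (use W0 in \<open>auto simp: mat_diag_def\<close>)
  define N where "N = mat_diag n (\<lambda>i. complex_of_real (1 / sqrt (d i)))"
  have N: "N \<in> carrier_mat n n" "mat_adjoint N = N" by (simp_all add: N_def)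
  define W where "W = W0 * N"
  have W: "W \<in> carrier_mat n n" using W0 N by (simp add: W_def)
  have "mat_adjoint W * W = N * mat_adjoint W0 * (W0 * N)"
    using mat_adjoint_mult[OF W0 N(1)] N by (simp add: W_def)
  also have "\<dots> = N * (mat_adjoint W0 * (W0 * N))"
    by (rule assoc_mult_mat[of _ n n _ n _ n]) (use W0 N in auto)
  also have "mat_adjoint W0 * (W0 * N) = mat_adjoint W0 * W0 * N"
    by (rule assoc_mult_mat[of _ n n _ n _ n, symmetric]) (use W0 N in auto)
  also have "N * (mat_adjoint W0 * W0 * N) = 1\<^sub>m n"
  proof -
    have "complex_of_real (1 / sqrt (d i)) * (complex_of_real (d i) * complex_of_real (1 / sqrt (d i))) = 1"
      if "i < n" for i
    proof -
      have "1 / sqrt (d i) * (d i * (1 / sqrt (d i))) = 1"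
        using d[OF that] by (simp add: field_simps)
      then show ?thesis by (simp only: of_real_1 flip: of_real_mult)
    qed
    then show ?thesis
      unfolding gram N_def mat_diag_diag
      by (intro eq_matI) (auto simp: mat_diag_def)
  qed
  finally have "unitary n W" using W by (intro unitaryI)
  moreover have "col W 0 = complex_of_real (1 / sqrt (d 0)) \<cdot>\<^sub>v v"
  proof (rule eq_vecI)
    fix i assume "i < dim_vec (complex_of_real (1 / sqrt (d 0)) \<cdot>\<^sub>v v)"
    then have i: "i < n" using v by simp
    have "W0 $$ (i, 0) = v $ i" using arg_cong[OF colW0[OF n], of "\<lambda>x. x $ i"] ws0 W0 i n by simp
    then show "col W 0 $ i = (complex_of_real (1 / sqrt (d 0)) \<cdot>\<^sub>v v) $ i"
      using i n v W0 W unfolding W_def N_def mat_diag_mult_right[OF W0] by simp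
  qed (use W v in simp)
  ultimately show thesis by (rule that)
qed

lemma hermitian_entry:
  "hermitian A \<Longrightarrow> A \<in> carrier_mat n n \<Longrightarrow> i < n \<Longrightarrow> j < n \<Longrightarrow> A $$ (i, j) = cnj (A $$ (j, i))"
  using mat_adjoint_index[of i A j] by (simp add: hermitian_def)

lemma hermitian_conj:
  assumes A: "hermitian A" "A \<in> carrier_mat n n" and W: "W \<in> carrier_mat n n"
  shows "hermitian (mat_adjoint W * A * W)"
proof -
  have Wa: "mat_adjoint W \<in> carrier_mat n n" using W by simp
  have "mat_adjoint (mat_adjoint W * A * W) = mat_adjoint W * (mat_adjoint (mat_adjoint W * A))"
    using A W Wa by (intro mat_adjoint_mult[of _ n n _ n]) auto
  also have "mat_adjoint (mat_adjoint W * A) = A * W"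
    using mat_adjoint_mult[OF Wa A(2)] A(1) by (simp add: hermitian_def)
  also have "mat_adjoint W * (A * W) = mat_adjoint W * A * W"
    by (rule assoc_mult_mat[symmetric, of _ n n _ n _ n]) (use A W Wa in auto)
  finally show ?thesis by (simp add: hermitian_def)
qed

lemma mat_diag_Suc:
  "mat_diag (Suc m) f = four_block_mat (mat_diag 1 f) (0\<^sub>m 1 m) (0\<^sub>m m 1) (mat_diag m (\<lambda>i. f (Suc i)))"
  by (intro eq_matI) (auto simp: mat_diag_def)

lemma mat_adjoint_four_block_diag:
  fixes A B :: "complex mat"
  assumes "A \<in> carrier_mat k k" "B \<in> carrier_mat m m"
  shows "mat_adjoint (four_block_mat A (0\<^sub>m k m) (0\<^sub>m m k) B)
    = four_block_mat (mat_adjoint A) (0\<^sub>m k m) (0\<^sub>m m k) (mat_adjoint B)"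
  using assms by (intro eq_matI) auto

lemma mult_four_block_diag:
  fixes A B C D :: "complex mat"
  assumes "A \<in> carrier_mat k k" "B \<in> carrier_mat m m" "C \<in> carrier_mat k k" "D \<in> carrier_mat m m"
  shows "four_block_mat A (0\<^sub>m k m) (0\<^sub>m m k) B * four_block_mat C (0\<^sub>m k m) (0\<^sub>m m k) D
    = four_block_mat (A * C) (0\<^sub>m k m) (0\<^sub>m m k) (B * D)"
  using assms by (subst mult_four_block_mat[of _ k k _ m _ m _ _ k _ m]) auto

lemma one_four_block: "1\<^sub>m (k + m) = four_block_mat (1\<^sub>m k) (0\<^sub>m k m) (0\<^sub>m m k) (1\<^sub>m m)"
  by (intro eq_matI) auto

text \<open>Induction on the dimension. In an orthonormal basis that starts with an eigenvector, the first
  column of the matrix is a multiple of the first unit vector; being Hermitian, the matrix then splits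
  into a \<open>1 \<times> 1\<close> block and a smaller Hermitian block. The eigenvalues may be prescribed in any
  order, which later permits sorted diagonals.\<close>

lemma hermitian_spectral_decomposition:
  assumes "A \<in> carrier_mat n n" "hermitian A" "char_poly A = (\<Prod>e\<leftarrow>es. [:- e, 1:])"
  shows "\<exists>U. unitary n U \<and> A = U * mat_diag n (\<lambda>i. es ! i) * mat_adjoint U"
  using assms
proof (induct es arbitrary: n A)
  case Nil
  then have n: "n = 0" using degree_monic_char_poly[of A n] by simp
  have "unitary n (1\<^sub>m n)" using n by (intro unitaryI eq_matI) auto
  moreover have "A = 1\<^sub>m n * mat_diag n (\<lambda>i. [] ! i) * mat_adjoint (1\<^sub>m n)"
    using Nil(1) n by (intro eq_matI) auto
  ultimately show ?case by blast
next
  case (Cons e es n A)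
  note A = Cons(2) and herm = Cons(3)
  have cp: "char_poly A = [:- e, 1:] * (\<Prod>e\<leftarrow>es. [:- e, 1:])" using Cons(4) by simp
  have "eigenvalue A e" unfolding eigenvalue_root_char_poly[OF A] cp by simp
  then obtain v where ev: "v \<in> carrier_vec n" "v \<noteq> 0\<^sub>v n" "A *\<^sub>v v = e \<cdot>\<^sub>v v"
    using A by (auto simp: eigenvalue_def eigenvector_def)
  obtain W c where W: "unitary n W" and col: "col W 0 = c \<cdot>\<^sub>v v"
    using unitary_first_column[OF ev(1,2)] by blast
  have Wc: "W \<in> carrier_mat n n" "mat_adjoint W \<in> carrier_mat n n"
    using W by (simp_all add: unitary_def)
  have WW: "mat_adjoint W * W = 1\<^sub>m n" "W * mat_adjoint W = 1\<^sub>m n"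
    using W by (simp_all add: unitary_def)
  obtain m where n: "n = Suc m"
  proof (cases n)
    case 0
    then have "v = 0\<^sub>v n" using ev(1) by (intro eq_vecI) auto
    with ev(2) show ?thesis by simp
  qed
  define A' where "A' = mat_adjoint W * A * W"
  have A': "A' \<in> carrier_mat n n" unfolding A'_def by (intro mult_carrier_mat[of _ n n] Wc A)
  have hermA': "hermitian A'" unfolding A'_def by (rule hermitian_conj[OF herm A Wc(1)])
  \<comment> \<open>The first column of \<open>W\<close> is an eigenvector, so \<open>W\<^sup>* A W\<close> maps the first unit vector to \<open>e\<close> times itself.\<close>
  have col0: "A' $$ (i, 0) = (if i = 0 then e else 0)" if i: "i < n" for i
  proof -
    have "A' = mat_adjoint W * (A * W)"
      unfolding A'_def by (rule assoc_mult_mat[of _ n n _ n _ n]) (use A Wc in auto)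
    then have "A' $$ (i, 0) = row (mat_adjoint W) i \<bullet> col (A * W) 0"
      using A Wc i n by simp
    also have "col (A * W) 0 = A *\<^sub>v col W 0"
      by (rule col_mult2[OF A Wc(1)]) (simp add: n)
    also have "\<dots> = e \<cdot>\<^sub>v col W 0"
      unfolding col using ev A by (simp add: mult_mat_vec smult_smult_assoc mult.commute)
    also have "row (mat_adjoint W) i \<bullet> (e \<cdot>\<^sub>v col W 0) = e * (mat_adjoint W * W) $$ (i, 0)"
      using Wc i n by simp
    finally show ?thesis using i n by (simp add: WW)
  qed
  define A3 where "A3 = Matrix.mat m m (\<lambda>(i, j). A' $$ (Suc i, Suc j))"
  have A3: "A3 \<in> carrier_mat m m" by (simp add: A3_def)
  have hermA3: "hermitian A3"
    unfolding hermitian_def by (intro eq_matI) (use hermitian_entry[OF hermA' A', symmetric] n in \<open>auto simp: A3_def\<close>)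
  have row0: "A' $$ (0, j) = (if j = 0 then e else 0)" if "j < n" for j
    using hermitian_entry[OF hermA' A', of 0 j] col0[of 0] col0[of j] that n by (cases "j = 0") auto
  have block: "A' = four_block_mat (mat_diag 1 (\<lambda>_. e)) (0\<^sub>m 1 m) (0\<^sub>m m 1) A3"
    by (intro eq_matI) (use A' n col0 row0 in \<open>auto simp: A3_def mat_diag_def\<close>)
  have AA': "A = W * A' * mat_adjoint W"
  proof -
    have "W * A' * mat_adjoint W = (W * mat_adjoint W) * A * (W * mat_adjoint W)"
      unfolding A'_def using A Wc
      by (simp add: assoc_mult_mat[of _ n n _ n _ n] mult_carrier_mat[of _ n n _ n])
    then show ?thesis using A by (simp add: WW)
  qed
  have "similar_mat A A'"
    unfolding similar_mat_def using A A' Wc WW AA'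
    by (intro exI[of _ W] exI[of _ "mat_adjoint W"] similar_mat_witI[of _ _ n]) auto
  then have "char_poly A = char_poly A'" by (rule char_poly_similar)
  also have "\<dots> = char_poly (mat_diag 1 (\<lambda>_. e)) * char_poly A3"
    unfolding block by (rule char_poly_four_block_zeros_col) (use A3 in auto)
  also have "char_poly (mat_diag 1 (\<lambda>_. e)) = [:- e, 1:]"
    by (simp add: mat_diag_def char_poly_defs det_def sign_def)
  finally have "[:- e, 1:] * char_poly A3 = [:- e, 1:] * (\<Prod>e\<leftarrow>es. [:- e, 1:])"
    unfolding cp by (rule sym)
  then have "char_poly A3 = (\<Prod>e\<leftarrow>es. [:- e, 1:])"
    by (simp del: mult_pCons_left)
  from Cons(1)[OF A3 hermA3 this] obtain U3 where U3: "unitary m U3"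
    and A3eq: "A3 = U3 * mat_diag m (\<lambda>i. es ! i) * mat_adjoint U3" by blast
  have U3c: "U3 \<in> carrier_mat m m" "mat_adjoint U3 \<in> carrier_mat m m" 
    using U3 by (simp_all add: unitary_def)
  define U' where "U' = four_block_mat (1\<^sub>m 1) (0\<^sub>m 1 m) (0\<^sub>m m 1) U3"
  define D where "D = mat_diag n (\<lambda>i. (e # es) ! i)"
  have adj1: "mat_adjoint (1\<^sub>m 1) = (1\<^sub>m 1 :: complex mat)" by (intro eq_matI) auto
  have U'c: "U' \<in> carrier_mat n n" unfolding U'_def n using U3c by auto
  have adjU': "mat_adjoint U' = four_block_mat (1\<^sub>m 1) (0\<^sub>m 1 m) (0\<^sub>m m 1) (mat_adjoint U3)"
    unfolding U'_def using mat_adjoint_four_block_diag[OF one_carrier_mat U3c(1)] adj1 by simp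
  have U'u: "unitary n U'"
  proof (rule unitaryI[OF U'c])
    show "mat_adjoint U' * U' = 1\<^sub>m n"
      unfolding adjU' unfolding U'_def
      using mult_four_block_diag[OF one_carrier_mat[of 1] U3c(2) one_carrier_mat U3c(1)]
        one_four_block[of 1 m] U3 by (simp add: n unitary_def)
  qed
  have A'eq: "A' = U' * D * mat_adjoint U'"
  proof -
    have "U' * D = four_block_mat (mat_diag 1 (\<lambda>_. e)) (0\<^sub>m 1 m) (0\<^sub>m m 1) (U3 * mat_diag m (\<lambda>i. es ! i))"
      unfolding U'_def D_def n mat_diag_Suc
      by (subst mult_four_block_diag) (use U3c in \<open>auto simp: mat_diag_def\<close>)
    moreover have "mat_diag 1 (\<lambda>_. e) * 1\<^sub>m 1 = mat_diag 1 (\<lambda>_. e)"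
      by (rule right_mult_one_mat[of _ 1]) simp
    ultimately show ?thesis
      unfolding block A3eq adjU'
      using mult_four_block_diag[OF mat_diag_dim[of 1 "\<lambda>_. e"] mult_carrier_mat[OF U3c(1) mat_diag_dim[of m "\<lambda>i. es ! i"]]
          one_carrier_mat U3c(2)] by simp
  qed
  have D: "D \<in> carrier_mat n n" by (simp add: D_def)
  have "A = (W * U') * D * mat_adjoint (W * U')"
    unfolding mat_adjoint_mult[OF Wc(1) U'c] AA' A'eq
    using Wc U'c D by (simp add: assoc_mult_mat[of _ n n _ n _ n] mult_carrier_mat[of _ n n _ n])
  moreover have "unitary n (W * U')" by (rule unitary_mult[OF W U'u])
  ultimately show ?case unfolding D_def by blast
qed

lemma proots_prod_linear: "proots (\<Prod>a\<leftarrow>as. [:- a, 1:]) = mset (as :: complex list)"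
proof (induct as)
  case (Cons a as)
  have "(\<Prod>a\<leftarrow>as. [:- a, 1:]) \<noteq> (0 :: complex poly)" by auto
  then show ?case using Cons by (simp add: proots_mult del: mult_pCons_left)
qed simp

lemma eigenvalue_list_char_poly:
  assumes "char_poly A = (\<Prod>a\<leftarrow>as. [:- a, 1:])"
  shows "eigenvalue_list A = rev (sort (map Re as))"
  using assms by (simp add: eigenvalue_list_def proots_prod_linear flip: mset_map)

text \<open>The converse direction: a unitary diagonalisation determines the characteristic polynomial, and
  therefore the sorted list of eigenvalues.\<close>

lemma char_poly_unitary_diag:
  assumes "unitary n U" "A = U * mat_diag n f * mat_adjoint U"
  shows "char_poly A = (\<Prod>a\<leftarrow>map f [0..<n]. [:- a, 1:])"
proof -
  have "similar_mat A (mat_diag n f)"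
    unfolding similar_mat_def using assms
    by (intro exI[of _ U] exI[of _ "mat_adjoint U"] similar_mat_witI[of _ _ n]) (auto simp: unitary_def)
  then have "char_poly A = char_poly (mat_diag n f)" by (rule char_poly_similar)
  also have "\<dots> = (\<Prod>a\<leftarrow>diag_mat (mat_diag n f). [:- a, 1:])"
    by (rule char_poly_upper_triangular[of _ n]) (auto simp: mat_diag_def)
  also have "diag_mat (mat_diag n f) = map f [0..<n]"
    by (auto simp: diag_mat_def mat_diag_def intro!: nth_equalityI)
  finally show ?thesis .
qed

lemma eigenvalue_list_unitary_diag:
  assumes "unitary n U" "A = U * mat_diag n (\<lambda>i. complex_of_real (f i)) * mat_adjoint U"
  shows "eigenvalue_list A = rev (sort (map f [0..<n]))"
  using eigenvalue_list_char_poly[OF char_poly_unitary_diag[OF assms]] by (simp add: o_def)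

text \<open>The diagonal of any unitary diagonalisation of a Hermitian matrix is real, so that taking real parts in the definition
  of \<open>eigenvalue_list\<close> loses no information; a second diagonalisation then uses the sorted order.\<close>

lemma hermitian_eigenvalue_list:
  assumes A: "A \<in> carrier_mat n n" and herm: "hermitian A"
  shows "length (eigenvalue_list A) = n"
    and "sorted_wrt (\<ge>) (eigenvalue_list A)"
    and "char_poly A = (\<Prod>a\<leftarrow>map complex_of_real (eigenvalue_list A). [:- a, 1:])"
    and "\<exists>U. unitary n U \<and> A = U * mat_diag n (\<lambda>i. complex_of_real (eigenvalue_list A ! i)) * mat_adjoint U"
proof -
  obtain as where as: "char_poly A = (\<Prod>a\<leftarrow>as. [:- a, 1:])" "length as = n"
    using char_poly_factorized[OF A] by blast
  obtain U where U: "unitary n U" and AU: "A = U * mat_diag n (\<lambda>i. as ! i) * mat_adjoint U"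
    using hermitian_spectral_decomposition[OF A herm as(1)] by blast
  define D where "D = mat_diag n (\<lambda>i. as ! i)"
  have Uc: "U \<in> carrier_mat n n" "mat_adjoint U \<in> carrier_mat n n" "D \<in> carrier_mat n n"
    using U by (simp_all add: unitary_def D_def)
  have "mat_adjoint U * A * U = (mat_adjoint U * U) * D * (mat_adjoint U * U)"
    unfolding AU D_def[symmetric] using Uc
    by (simp add: assoc_mult_mat[of _ n n _ n _ n] mult_carrier_mat[of _ n n _ n])
  also have "\<dots> = D"
    using U Uc(3) by (simp add: unitary_def)
  finally have "hermitian D" using hermitian_conj[OF herm A Uc(1)] by simp
  have real: "as ! i = complex_of_real (Re (as ! i))" if "i < n" for i
    using hermitian_entry[OF \<open>hermitian D\<close> Uc(3) that that] that
    by (simp add: D_def mat_diag_def complex_eq_iff)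
  have ev: "eigenvalue_list A = rev (sort (map Re as))"
    by (rule eigenvalue_list_char_poly[OF as(1)])
  then show len: "length (eigenvalue_list A) = n" using as(2) by simp
  show "sorted_wrt (\<ge>) (eigenvalue_list A)"
    unfolding ev sorted_wrt_rev by simp
  have "mset (map complex_of_real (eigenvalue_list A)) = mset (map complex_of_real (map Re as))"
    by (simp only: ev mset_map mset_rev mset_sort)
  also have "map complex_of_real (map Re as) = as"
    using real as(2) by (intro nth_equalityI) auto
  finally have eq: "mset (map complex_of_real (eigenvalue_list A)) = mset as" .
  have "prod_mset (image_mset (\<lambda>a. [:- a, 1:]) (mset (map complex_of_real (eigenvalue_list A))))
      = prod_mset (image_mset (\<lambda>a. [:- a, 1:]) (mset as))"
    unfolding eq ..
  then show cp: "char_poly A = (\<Prod>a\<leftarrow>map complex_of_real (eigenvalue_list A). [:- a, 1:])"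
    unfolding as(1) unfolding mset_map[symmetric] prod_mset_prod_list by (rule sym)
  obtain V where V: "unitary n V"
    "A = V * mat_diag n (\<lambda>i. map complex_of_real (eigenvalue_list A) ! i) * mat_adjoint V"
    using hermitian_spectral_decomposition[OF A herm cp] by blast
  have "mat_diag n (\<lambda>i. map complex_of_real (eigenvalue_list A) ! i)
      = mat_diag n (\<lambda>i. complex_of_real (eigenvalue_list A ! i))"
    using len by (intro eq_matI) (auto simp: mat_diag_def)
  then show "\<exists>U. unitary n U \<and> A = U * mat_diag n (\<lambda>i. complex_of_real (eigenvalue_list A ! i)) * mat_adjoint U"
    using V by auto
qed

section \<open>Square roots and singular values\<close>

text \<open>Instances of the product laws with a single dimension: once \<open>n\<close> is given, the simplifier can discharge
  all carrier conditions and reassociate long products.\<close>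

lemma mult_closed_square: "A \<in> carrier_mat n n \<Longrightarrow> B \<in> carrier_mat n n \<Longrightarrow> A * B \<in> carrier_mat n n"
  by (rule mult_carrier_mat)

lemma mult_assoc_square:
  fixes A B C :: "complex mat"
  shows "A \<in> carrier_mat n n \<Longrightarrow> B \<in> carrier_mat n n \<Longrightarrow> C \<in> carrier_mat n n \<Longrightarrow> A * B * C = A * (B * C)"
  by (rule assoc_mult_mat)

lemma pos_semidef_gram:
  assumes M: "M \<in> carrier_mat n n"
  shows "pos_semidef (mat_adjoint M * M)"
proof -
  have Ma: "mat_adjoint M \<in> carrier_mat n n" using M by simp
  have herm: "hermitian (mat_adjoint M * M)"
    using mat_adjoint_mult[OF Ma M] by (simp add: hermitian_def)
  have "Re ((mat_adjoint M * M *\<^sub>v v) \<bullet>c v) \<ge> 0" if v: "v \<in> carrier_vec n" for v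
  proof -
    have Mv: "M *\<^sub>v v \<in> carrier_vec n" using M v by simp
    have "mat_adjoint M * M *\<^sub>v v = mat_adjoint M *\<^sub>v (M *\<^sub>v v)"
      by (rule assoc_mult_mat_vec) (use M Ma v in auto)
    then have "(mat_adjoint M * M *\<^sub>v v) \<bullet>c v = (M *\<^sub>v v) \<bullet>c (M *\<^sub>v v)"
      using cscalar_prod_adjoint[OF Ma Mv v] by simp
    then show ?thesis using sqnorm_nonneg by (simp add: cscalar_prod_self)
  qed
  with herm show ?thesis using M by (simp add: pos_semidef_def)
qed

text \<open>Each \<open>f i\<close> is the value of the quadratic form of \<open>B\<close> at the \<open>i\<close>-th column of \<open>U\<close>, a unit vector.\<close>

lemma pos_semidef_diagonal_nonneg:
  assumes psd: "pos_semidef B" and U: "unitary n U"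
    and B: "B = U * mat_diag n (\<lambda>i. complex_of_real (f i)) * mat_adjoint U" and i: "i < n"
  shows "0 \<le> f i"
proof -
  define D where "D = mat_diag n (\<lambda>i. complex_of_real (f i))"
  define u where "u = (unit_vec n i :: complex vec)"
  define w where "w = U *\<^sub>v u"
  have c: "U \<in> carrier_mat n n" "mat_adjoint U \<in> carrier_mat n n" "D \<in> carrier_mat n n"
    using U by (simp_all add: unitary_def D_def)
  have u: "u \<in> carrier_vec n" by (simp add: u_def)
  have w: "w \<in> carrier_vec n" using c u unfolding w_def by (intro mult_mat_vec_carrier)
  have Bc: "B \<in> carrier_mat n n" unfolding B D_def[symmetric] using c by (intro mult_closed_square)
  have "B * U = U * D * (mat_adjoint U * U)"
    unfolding B D_def[symmetric] using c by (simp add: mult_assoc_square mult_closed_square)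
  also have "\<dots> = U * D" using U c by (simp add: unitary_def mult_closed_square)
  finally have BU: "B * U = U * D" .
  have Du: "D *\<^sub>v u = complex_of_real (f i) \<cdot>\<^sub>v u"
    using i by (intro eq_vecI) (auto simp: D_def u_def mat_diag_def)
  have "B *\<^sub>v w = (B * U) *\<^sub>v u"
    unfolding w_def by (rule assoc_mult_mat_vec[OF Bc c(1) u, symmetric])
  also have "\<dots> = U *\<^sub>v (D *\<^sub>v u)"
    unfolding BU by (rule assoc_mult_mat_vec[OF c(1) c(3) u])
  also have "\<dots> = complex_of_real (f i) \<cdot>\<^sub>v w"
    unfolding Du w_def by (rule mult_mat_vec[OF c(1) u])
  finally have "B *\<^sub>v w = complex_of_real (f i) \<cdot>\<^sub>v w" .
  then have q: "(B *\<^sub>v w) \<bullet>c w = complex_of_real (f i * sqnorm w)"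
    using w by (simp add: cscalar_prod_self)
  have "complex_of_real (sqnorm w) = u \<bullet>c u"
    using sqnorm_mult_mat_vec[OF c(1) u] U u by (simp add: w_def unitary_def)
  also have "u \<bullet>c u = 1" using i by (simp add: u_def cscalar_prod_self sqnorm_unit_vec)
  finally have "sqnorm w = 1" by simp
  then have "(B *\<^sub>v w) \<bullet>c w = complex_of_real (f i)" using q by simp
  moreover have "Re ((B *\<^sub>v w) \<bullet>c w) \<ge> 0"
    using psd w Bc by (simp add: pos_semidef_def)
  ultimately show ?thesis by simp
qed

text \<open>Existence of the positive semidefinite square root is a computation. For uniqueness, let
  \<open>B = R E R\<^sup>*\<close> be another one. The unitary \<open>M = R\<^sup>* V\<close> satisfies \<open>E\<^sup>2 M = M D\<close>, that is,
  \<open>e\<^sub>i\<^sup>2 m\<^sub>i\<^sub>j = m\<^sub>i\<^sub>j d\<^sub>j\<close>. Where \<open>m\<^sub>i\<^sub>j\<close> does not vanish this gives \<open>e\<^sub>i = \<surd>d\<^sub>j\<close>, since both are nonnegative, so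
  \<open>M\<close> intertwines \<open>E\<close> with the square root of \<open>D\<close> as well.\<close>

lemma mat_sqrt_unitary_diag:
  assumes V: "unitary n V" and d: "\<And>i. i < n \<Longrightarrow> 0 \<le> d i"
    and A: "A = V * mat_diag n (\<lambda>i. complex_of_real (d i)) * mat_adjoint V"
  shows "mat_sqrt A = V * mat_diag n (\<lambda>i. complex_of_real (sqrt (d i))) * mat_adjoint V"
proof -
  define S where "S = mat_diag n (\<lambda>i. complex_of_real (sqrt (d i)))"
  define D where "D = mat_diag n (\<lambda>i. complex_of_real (d i))"
  have c: "V \<in> carrier_mat n n" "mat_adjoint V \<in> carrier_mat n n" "S \<in> carrier_mat n n" "D \<in> carrier_mat n n"
    using V by (simp_all add: unitary_def D_def S_def)
  note sq = mult_assoc_square[where n = n] mult_closed_square[where n = n]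
    left_mult_one_mat[of _ n n] right_mult_one_mat[of _ n n]
  have VV: "mat_adjoint V * V = 1\<^sub>m n" "V * mat_adjoint V = 1\<^sub>m n" using V by (simp_all add: unitary_def)
  have dimA: "dim_row A = n" unfolding A using c by simp
  have SS: "S * S = D"
    unfolding D_def S_def mat_diag_diag
    using d by (intro eq_matI) (auto simp: mat_diag_def simp flip: of_real_mult)
  have square: "(V * S * mat_adjoint V) * (V * S * mat_adjoint V) = A"
  proof -
    have "(V * S * mat_adjoint V) * (V * S * mat_adjoint V)
        = V * (S * ((mat_adjoint V * V) * (S * mat_adjoint V)))"
      using c by (simp add: sq)
    also have "\<dots> = V * ((S * S) * mat_adjoint V)"
      unfolding VV using c by (simp add: sq)
    also have "\<dots> = A" unfolding SS A D_def[symmetric] using c by (simp add: sq)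
    finally show ?thesis .
  qed
  have psd: "pos_semidef (V * S * mat_adjoint V)"
  proof -
    \<comment> \<open>Fourth roots of the eigenvalues exhibit the candidate as a Gram matrix.\<close>
    define R where "R = mat_diag n (\<lambda>i. complex_of_real (sqrt (sqrt (d i))))"
    have RR: "R * R = S"
      unfolding R_def S_def mat_diag_diag
      using d by (intro eq_matI) (auto simp: mat_diag_def simp flip: of_real_mult)
    have R: "R \<in> carrier_mat n n" "mat_adjoint R = R" by (simp_all add: R_def)
    have "mat_adjoint (R * mat_adjoint V) * (R * mat_adjoint V) = V * S * mat_adjoint V"
      unfolding mat_adjoint_mult[OF R(1) c(2)] R(2) mat_adjoint_adjoint
      using c R(1) by (simp add: sq flip: RR)
    then show ?thesis
      using pos_semidef_gram[of "R * mat_adjoint V" n] c R(1) by (simp add: sq)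
  qed
  have unique: "B = V * S * mat_adjoint V"
    if B: "B \<in> carrier_mat n n" and psdB: "pos_semidef B" and BB: "B * B = A" for B
  proof -
    define e where "e i = eigenvalue_list B ! i" for i
    obtain R where R: "unitary n R" and Beq: "B = R * mat_diag n (\<lambda>i. complex_of_real (e i)) * mat_adjoint R"
      using hermitian_eigenvalue_list(4)[OF B] psdB by (auto simp: pos_semidef_def e_def)
    define E where "E = mat_diag n (\<lambda>i. complex_of_real (e i))"
    have Rc: "R \<in> carrier_mat n n" "mat_adjoint R \<in> carrier_mat n n" "E \<in> carrier_mat n n"
      using R by (simp_all add: unitary_def E_def)
    have RR: "mat_adjoint R * R = 1\<^sub>m n" "R * mat_adjoint R = 1\<^sub>m n" using R by (simp_all add: unitary_def)
    note Beq = Beq[folded E_def]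
    have e: "0 \<le> e i" if "i < n" for i
      using pos_semidef_diagonal_nonneg[OF psdB R Beq[unfolded E_def] that] .
    define M where "M = mat_adjoint R * V"
    have M: "M \<in> carrier_mat n n" unfolding M_def using c Rc by (intro mult_closed_square)
    have "E * E * M = M * D"
    proof -
      have "mat_adjoint R * (B * B) * V = (mat_adjoint R * R) * (E * ((mat_adjoint R * R) * (E * (mat_adjoint R * V))))"
        unfolding Beq using c Rc by (simp add: sq)
      also have "\<dots> = E * E * M" unfolding RR M_def using c Rc by (simp add: sq)
      finally have 1: "mat_adjoint R * (B * B) * V = E * E * M" .
      have "mat_adjoint R * A * V = (mat_adjoint R * V) * (D * (mat_adjoint V * V))"
        unfolding A D_def[symmetric] using c Rc by (simp add: sq)
      also have "\<dots> = M * D" unfolding VV M_def using c Rc by (simp add: sq)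
      finally show ?thesis using 1 unfolding BB by simp
    qed
    then have entry: "complex_of_real (e i * e i) * M $$ (i, j) = M $$ (i, j) * complex_of_real (d j)"
      if "i < n" "j < n" for i j
    proof -
      have "(E * E * M) $$ (i, j) = (M * D) $$ (i, j)" using \<open>E * E * M = M * D\<close> by simp
      then show ?thesis
        using that M unfolding E_def D_def mat_diag_diag mat_diag_mult_left[OF M] mat_diag_mult_right[OF M]
        by simp
    qed
    have entry_sqrt: "complex_of_real (e i) * M $$ (i, j) = M $$ (i, j) * complex_of_real (sqrt (d j))"
      if ij: "i < n" "j < n" for i j
    proof (cases "M $$ (i, j) = 0")
      case False
      then have "complex_of_real (e i * e i) = complex_of_real (d j)" using entry[OF ij] by simp
      then have "e i * e i = d j" by (simp only: of_real_eq_iff)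
      then have "sqrt (d j) = \<bar>e i\<bar>" by (simp flip: real_sqrt_abs2)
      then have "sqrt (d j) = e i" using e[OF ij(1)] by simp
      then show ?thesis by simp
    qed simp
    have EM: "E * M = M * S"
      unfolding E_def S_def mat_diag_mult_left[OF M] mat_diag_mult_right[OF M]
      by (intro eq_matI) (use entry_sqrt in auto)
    have "B = R * (E * (mat_adjoint R * (V * mat_adjoint V)))"
      unfolding Beq VV using c Rc by (simp add: sq)
    also have "\<dots> = R * ((E * M) * mat_adjoint V)" unfolding M_def using c Rc by (simp add: sq)
    also have "\<dots> = (R * mat_adjoint R) * (V * (S * mat_adjoint V))"
      unfolding EM unfolding M_def using c Rc by (simp add: sq)
    also have "\<dots> = V * S * mat_adjoint V" unfolding RR using c by (simp add: sq)
    finally show ?thesis .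
  qed
  show ?thesis
    unfolding mat_sqrt_def dimA S_def[symmetric]
    by (rule the_equality) (use c square psd unique in \<open>auto simp: mult_closed_square\<close>)
qed

lemma rev_sort_decreasing:
  fixes xs :: "real list"
  shows "sorted_wrt (\<ge>) xs \<Longrightarrow> rev (sort xs) = xs"
  using properties_for_sort[of "rev xs" xs] by (simp add: sorted_wrt_rev)

text \<open>The matrix \<open>Y = C Z S\<^sup>+\<close>, with \<open>S\<^sup>+\<close> the pseudoinverse of the diagonal matrix \<open>S\<close>, is only a partial
  isometry. It is left this way because the argument below uses nothing but the contraction property;
  completing it to a unitary matrix would require another basis extension.\<close>

lemma singular_value_decomposition:
  assumes C: "C \<in> carrier_mat n n"
  defines "S \<equiv> mat_diag n (\<lambda>i. complex_of_real (singular_values C ! i))"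
  shows "length (singular_values C) = n" "sorted_wrt (\<ge>) (singular_values C)"
    and "\<forall>s \<in> set (singular_values C). 0 \<le> s"
    and "\<exists>Y Z. contraction n Y \<and> unitary n Z \<and> C = Y * S * mat_adjoint Z \<and> mat_adjoint Y * C * Z = S"
proof -
  define A where "A = mat_adjoint C * C"
  define d where "d = eigenvalue_list A"
  note sq = mult_assoc_square[where n = n] mult_closed_square[where n = n]
    left_mult_one_mat[of _ n n] right_mult_one_mat[of _ n n]
  have Ca: "mat_adjoint C \<in> carrier_mat n n" using C by simp
  have psd: "pos_semidef A" unfolding A_def by (rule pos_semidef_gram[OF C])
  have A: "A \<in> carrier_mat n n" "hermitian A"
    using C psd by (simp_all add: A_def pos_semidef_def sq)
  have len: "length d = n" and sorted: "sorted_wrt (\<ge>) d"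
    using hermitian_eigenvalue_list(1,2)[OF A] by (simp_all add: d_def)
  obtain Z where Z: "unitary n Z" and AZ: "A = Z * mat_diag n (\<lambda>i. complex_of_real (d ! i)) * mat_adjoint Z"
    using hermitian_eigenvalue_list(4)[OF A] by (auto simp: d_def)
  have d: "0 \<le> d ! i" if "i < n" for i
    using pos_semidef_diagonal_nonneg[OF psd Z AZ that] .
  have "eigenvalue_list (mat_sqrt A) = rev (sort (map (\<lambda>i. sqrt (d ! i)) [0..<n]))"
    by (rule eigenvalue_list_unitary_diag[OF Z mat_sqrt_unitary_diag[OF Z d AZ]])
  also have "map (\<lambda>i. sqrt (d ! i)) [0..<n] = map sqrt d"
    using len by (intro nth_equalityI) auto
  also have "rev (sort (map sqrt d)) = map sqrt d"
    using sorted by (intro rev_sort_decreasing) (simp add: sorted_wrt_map)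
  finally have sv: "singular_values C = map sqrt d" by (simp add: singular_values_def A_def)
  show "length (singular_values C) = n" using len by (simp add: sv)
  show "sorted_wrt (\<ge>) (singular_values C)" using sorted by (simp add: sv sorted_wrt_map)
  show "\<forall>s \<in> set (singular_values C). 0 \<le> s"
    using d len by (auto simp: sv in_set_conv_nth)
  define s where "s i = sqrt (d ! i)" for i
  have s2: "s i * s i = d ! i" if "i < n" for i using d[OF that] by (simp add: s_def)
  have S: "S = mat_diag n (\<lambda>i. complex_of_real (s i))"
    unfolding S_def sv using len by (intro eq_matI) (auto simp: mat_diag_def s_def)
  define D where "D = mat_diag n (\<lambda>i. complex_of_real (d ! i))"
  \<comment> \<open>The entries of the pseudoinverse of \<open>S\<close>.\<close>
  define t where "t i = (if s i = 0 then 0 else 1 / s i)" for i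
  define T where "T = mat_diag n (\<lambda>i. complex_of_real (t i))"
  define Y where "Y = C * Z * T"
  have c: "Z \<in> carrier_mat n n" "mat_adjoint Z \<in> carrier_mat n n" "T \<in> carrier_mat n n"
    "S \<in> carrier_mat n n" "D \<in> carrier_mat n n"
    using Z by (simp_all add: unitary_def T_def S D_def)
  have ZZ: "mat_adjoint Z * Z = 1\<^sub>m n" "Z * mat_adjoint Z = 1\<^sub>m n" using Z by (simp_all add: unitary_def)
  have CZ: "C * Z \<in> carrier_mat n n" "mat_adjoint (C * Z) \<in> carrier_mat n n"
    using C c by (simp_all add: sq)
  have gram: "mat_adjoint (C * Z) * (C * Z) = D"
  proof -
    have "mat_adjoint (C * Z) * (C * Z) = mat_adjoint Z * A * Z"
      unfolding mat_adjoint_mult[OF C c(1)] A_def using C Ca c by (simp add: sq)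
    also have "\<dots> = (mat_adjoint Z * Z) * (D * (mat_adjoint Z * Z))"
      unfolding AZ D_def[symmetric] using c by (simp add: sq)
    also have "\<dots> = D" unfolding ZZ using c by simp
    finally show ?thesis .
  qed
  have Y: "Y \<in> carrier_mat n n" unfolding Y_def using CZ c by (simp add: sq)
  have Ya: "mat_adjoint Y = T * mat_adjoint (C * Z)"
    unfolding Y_def mat_adjoint_mult[OF CZ(1) c(3)] by (simp add: T_def)
  have "mat_adjoint Y * Y = T * (mat_adjoint (C * Z) * (C * Z)) * T"
    unfolding Ya unfolding Y_def using CZ c by (simp only: sq)
  also have "\<dots> = mat_diag n (\<lambda>i. complex_of_real (if s i = 0 then 0 else 1))"
    unfolding gram unfolding T_def D_def mat_diag_diag
    by (intro eq_matI) (auto simp: mat_diag_def t_def simp flip: s2 of_real_mult)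
  finally have "contraction n Y"
    by (intro contraction_gramI[OF Y]) auto
  moreover have "mat_adjoint Y * C * Z = S"
  proof -
    have "mat_adjoint Y * C * Z = T * (mat_adjoint (C * Z) * (C * Z))"
      unfolding Ya using CZ(2) C c by (simp only: sq)
    also have "\<dots> = S"
      unfolding gram unfolding T_def D_def S mat_diag_diag
      by (intro eq_matI) (auto simp: mat_diag_def t_def simp flip: s2 of_real_mult)
    finally show ?thesis .
  qed
  moreover have "C = Y * S * mat_adjoint Z"
  proof -
    have "Y * S = C * Z * (T * S)" unfolding Y_def using CZ(1) c by (simp only: sq)
    also have "T * S = mat_diag n (\<lambda>i. complex_of_real (if s i = 0 then 0 else 1))"
      unfolding T_def S mat_diag_diag
      by (intro eq_matI) (auto simp: mat_diag_def t_def)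
    also have "C * Z * \<dots> = C * Z"
    proof -
      define K where "K = C * Z"
      have K: "K \<in> carrier_mat n n" "mat_adjoint K * K = D" using CZ gram by (simp_all add: K_def)
      \<comment> \<open>Multiplication by \<open>T * S\<close> erases the columns of \<open>C Z\<close> that belong to vanishing singular values; they are zero anyway.\<close>
      have null: "K $$ (i, j) = 0" if ij: "i < n" "j < n" "s j = 0" for i j
      proof -
        have "d ! j = 0" using s2[OF ij(2)] ij(3) by simp
        have "complex_of_real (sqnorm (col K j)) = col K j \<bullet>c col K j"
          by (simp only: cscalar_prod_self)
        also have "\<dots> = (mat_adjoint K * K) $$ (j, j)"
          using ij K(1) by (auto simp: scalar_prod_def mult.commute intro!: sum.cong)
        also have "\<dots> = 0" unfolding K D_def using ij \<open>d ! j = 0\<close> by (simp add: mat_diag_def)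
        finally have "sqnorm (col K j) = 0" by simp
        then have "col K j $ i = 0" using ij K(1) by (intro sqnorm_eq_0) auto
        then show ?thesis using ij K(1) by simp
      qed
      show ?thesis
        unfolding K_def[symmetric] mat_diag_mult_right[OF K(1)]
        by (intro eq_matI) (use K(1) null in auto)
    qed
    finally have "Y * S * mat_adjoint Z = C * (Z * mat_adjoint Z)" using C c by (simp add: sq)
    then show ?thesis unfolding ZZ using C by simp
  qed
  ultimately show "\<exists>Y Z. contraction n Y \<and> unitary n Z \<and> C = Y * S * mat_adjoint Z \<and> mat_adjoint Y * C * Z = S"
    using Z by blast
qed

section \<open>Traces\<close>

definition mat_trace :: "complex mat \<Rightarrow> complex" where
  "mat_trace A = (\<Sum>i<dim_row A. A $$ (i, i))"

lemma mat_trace_comm: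
  assumes "A \<in> carrier_mat n m" "B \<in> carrier_mat m n"
  shows "mat_trace (A * B) = mat_trace (B * A)"
proof -
  have "mat_trace (A * B) = (\<Sum>i<n. \<Sum>j<m. A $$ (i, j) * B $$ (j, i))"
    using assms by (auto simp: mat_trace_def scalar_prod_def lessThan_atLeast0 intro!: sum.cong)
  also have "\<dots> = (\<Sum>j<m. \<Sum>i<n. A $$ (i, j) * B $$ (j, i))"
    by (rule sum.swap)
  also have "\<dots> = mat_trace (B * A)"
    using assms by (auto simp: mat_trace_def scalar_prod_def lessThan_atLeast0 mult.commute intro!: sum.cong)
  finally show ?thesis .
qed

lemma mat_trace_minus:
  "A \<in> carrier_mat n n \<Longrightarrow> B \<in> carrier_mat n n \<Longrightarrow> mat_trace (A - B) = mat_trace A - mat_trace B"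
  by (auto simp: mat_trace_def simp flip: sum_subtractf intro!: sum.cong)

lemma mat_trace_diag_mult:
  "M \<in> carrier_mat n n \<Longrightarrow> mat_trace (mat_diag n f * M) = (\<Sum>i<n. f i * M $$ (i, i))"
  by (simp add: mat_diag_mult_left mat_trace_def)

lemma mat_trace_truncation_mult:
  assumes "M \<in> carrier_mat n n" "k \<le> n"
  shows "mat_trace (truncation n k * M) = (\<Sum>i<k. M $$ (i, i))"
proof -
  have "mat_trace (truncation n k * M) = (\<Sum>i<n. if i < k then M $$ (i, i) else 0)"
    unfolding truncation_def mat_trace_diag_mult[OF assms(1)] by (intro sum.cong) auto
  also have "\<dots> = (\<Sum>i<k. M $$ (i, i))"
    using assms(2) by (intro sum.mono_neutral_cong_right) auto
  finally show ?thesis .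
qed

section \<open>Trace estimate by the spectral spread\<close>

lemma sorted_ge_nth_mono:
  assumes "sorted_wrt (\<ge>) xs" "i \<le> j" "j < length xs"
  shows "xs ! j \<le> (xs ! i :: real)"
  using assms sorted_wrt_nth_less[of "(\<ge>)" xs i j] by (cases "i = j") auto

text \<open>Scalar core of the theorem: weights in \<open>[-1, 1]\<close> of total sum \<open>0\<close> and total mass at most \<open>2 r\<close> can at
  best put \<open>+1\<close> on the \<open>r\<close> largest and \<open>-1\<close> on the \<open>r\<close> smallest entries. Let \<open>p\<close> be the \<open>r\<close>-th largest and
  \<open>q\<close> the \<open>r\<close>-th smallest entry, with midpoint \<open>c\<close> and half distance \<open>\<delta>\<close>. As the weights sum to \<open>0\<close>, every
  entry \<open>x\<close> may be replaced by \<open>x - c\<close>, and \<open>\<bar>x - c\<bar>\<close> is at most \<open>\<delta>\<close> plus the excess \<open>\<phi> x\<close> of \<open>x\<close> over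
  the interval \<open>[q, p]\<close>. The sum of the excesses is a symmetric function of the entries and can be
  evaluated on the sorted list, so no rearrangement of the weights is needed.\<close>

lemma balanced_weighted_sum_le:
  fixes d h \<mu> :: "real list"
  assumes len: "length d = m" "length h = m"
    and perm: "mset \<mu> = mset d" and sorted: "sorted_wrt (\<ge>) \<mu>"
    and bound: "\<And>i. i < m \<Longrightarrow> \<bar>h ! i\<bar> \<le> 1"
    and balanced: "(\<Sum>i<m. h ! i) = 0"
    and mass: "(\<Sum>i<m. \<bar>h ! i\<bar>) \<le> 2 * real r" and r: "2 * r \<le> m"
  shows "(\<Sum>i<m. d ! i * h ! i) \<le> (\<Sum>i<r. \<mu> ! i - \<mu> ! (m - 1 - i))"
proof (cases "r = 0")
  case True
  have "(\<Sum>i<m. \<bar>h ! i\<bar>) = 0"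
    using mass True by (intro antisym) (auto intro: sum_nonneg)
  then have "h ! i = 0" if "i < m" for i
    using that by (simp add: sum_nonneg_eq_0_iff)
  then show ?thesis using True by simp
next
  case False
  have len\<mu>: "length \<mu> = m" using arg_cong[OF perm, of size] len(1) by simp
  define p q where "p = \<mu> ! (r - 1)" and "q = \<mu> ! (m - r)"
  define c \<delta> where "c = (p + q) / 2" and "\<delta> = (p - q) / 2"
  have "q \<le> p" unfolding p_def q_def using sorted len\<mu> r False by (intro sorted_ge_nth_mono) auto
  then have \<delta>: "0 \<le> \<delta>" by (simp add: \<delta>_def)
  define \<phi> where "\<phi> x = max 0 (x - p) + max 0 (q - x)" for x :: real
  have \<phi>0: "0 \<le> \<phi> x" for x by (simp add: \<phi>_def)
  have point: "(x - c) * y \<le> \<delta> * \<bar>y\<bar> + \<phi> x" if "\<bar>y\<bar> \<le> 1" for x y :: real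
  proof -
    have "\<bar>x - c\<bar> \<le> \<delta> + \<phi> x"
      using \<open>q \<le> p\<close> unfolding \<phi>_def c_def \<delta>_def max_def by (auto simp: abs_if field_simps)
    then have "\<bar>x - c\<bar> * \<bar>y\<bar> \<le> (\<delta> + \<phi> x) * \<bar>y\<bar>" by (rule mult_right_mono) simp
    also have "\<dots> \<le> \<delta> * \<bar>y\<bar> + \<phi> x"
      using mult_left_mono[OF that \<phi>0[of x]] by (simp add: distrib_right)
    finally show ?thesis
      using abs_ge_self[of "(x - c) * y"] by (simp add: abs_mult)
  qed
  have "(\<Sum>i<m. d ! i * h ! i) = (\<Sum>i<m. (d ! i - c) * h ! i) + c * (\<Sum>i<m. h ! i)"
    by (simp add: left_diff_distrib sum_subtractf sum_distrib_left)
  also have "\<dots> \<le> (\<Sum>i<m. \<delta> * \<bar>h ! i\<bar> + \<phi> (d ! i))"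
    unfolding balanced mult_zero_right add_0_right by (intro sum_mono point bound) simp
  also have "\<dots> = \<delta> * (\<Sum>i<m. \<bar>h ! i\<bar>) + (\<Sum>i<m. \<phi> (d ! i))"
    by (simp add: sum.distrib sum_distrib_left)
  also have "\<delta> * (\<Sum>i<m. \<bar>h ! i\<bar>) \<le> \<delta> * (2 * real r)"
    using mass \<delta> by (rule mult_left_mono)
  also have "(\<Sum>i<m. \<phi> (d ! i)) = (\<Sum>i<m. \<phi> (\<mu> ! i))"
  proof -
    have nth: "(\<Sum>i<m. \<phi> (xs ! i)) = sum_mset (image_mset \<phi> (mset xs))" if "length xs = m" for xs
      unfolding mset_map[symmetric] sum_mset_sum_list
      using that by (simp add: sum_list_sum_nth lessThan_atLeast0)
    show ?thesis unfolding nth[OF len(1)] nth[OF len\<mu>] perm ..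
  qed
  also have "(\<Sum>i<m. \<phi> (\<mu> ! i)) = (\<Sum>i<m. max 0 (\<mu> ! i - p)) + (\<Sum>i<m. max 0 (q - \<mu> ! i))"
    by (simp add: \<phi>_def sum.distrib)
  also have "(\<Sum>i<m. max 0 (\<mu> ! i - p)) = (\<Sum>i<r. \<mu> ! i - p)"
  proof (rule sum.mono_neutral_cong_right)
    show "\<forall>i \<in> {..<m} - {..<r}. max 0 (\<mu> ! i - p) = 0"
      using sorted_ge_nth_mono[OF sorted, of "r - 1"] len\<mu> by (auto simp: p_def)
    show "max 0 (\<mu> ! i - p) = \<mu> ! i - p" if "i \<in> {..<r}" for i
      using sorted_ge_nth_mono[OF sorted, of i "r - 1"] len\<mu> that r by (auto simp: p_def)
  qed (use r in auto)
  also have "(\<Sum>i<m. max 0 (q - \<mu> ! i)) = (\<Sum>i<m. max 0 (q - \<mu> ! (m - Suc i)))"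
    by (rule sum.nat_diff_reindex[symmetric])
  also have "\<dots> = (\<Sum>i<r. q - \<mu> ! (m - Suc i))"
  proof (rule sum.mono_neutral_cong_right)
    show "\<forall>i \<in> {..<m} - {..<r}. max 0 (q - \<mu> ! (m - Suc i)) = 0"
      using sorted_ge_nth_mono[OF sorted, of _ "m - r"] len\<mu> False r by (auto simp: q_def)
    show "max 0 (q - \<mu> ! (m - Suc i)) = q - \<mu> ! (m - Suc i)" if "i \<in> {..<r}" for i
      using sorted_ge_nth_mono[OF sorted, of "m - r" "m - Suc i"] len\<mu> that r by (auto simp: q_def)
  qed (use r in auto)
  also have "\<delta> * (2 * real r) + ((\<Sum>i<r. \<mu> ! i - p) + (\<Sum>i<r. q - \<mu> ! (m - Suc i)))
      = (\<Sum>i<r. \<mu> ! i - \<mu> ! (m - 1 - i))"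
    by (simp add: sum_subtractf \<delta>_def field_simps)
  finally show ?thesis by simp
qed

lemma direct_sum_eigenvalue_list:
  assumes A: "A \<in> carrier_mat n n" "hermitian A" and B: "B \<in> carrier_mat m m" "hermitian B"
  shows "eigenvalue_list (direct_sum_mat A B) = rev (sort (eigenvalue_list A @ eigenvalue_list B))"
proof -
  note cA = hermitian_eigenvalue_list(3)[OF A] and cB = hermitian_eigenvalue_list(3)[OF B]
  have "char_poly (direct_sum_mat A B) = char_poly A * char_poly B"
  proof (rule char_poly_0_block[OF _ _ _ A(1) zero_carrier_mat B(1)])
    show "direct_sum_mat A B = four_block_mat A (0\<^sub>m n m) (0\<^sub>m m n) B"
      using A B by (simp add: direct_sum_mat_def)
  qed (rule exI, rule cA, rule exI, rule cB)
  then have "char_poly (direct_sum_mat A B)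
      = (\<Prod>a\<leftarrow>map complex_of_real (eigenvalue_list A @ eigenvalue_list B). [:- a, 1:])"
    using cA cB by simp
  from eigenvalue_list_char_poly[OF this] show ?thesis by (simp add: o_def)
qed

text \<open>The core estimate, with contractions \<open>P\<close> and \<open>W\<close> of rank at most \<open>k\<close> and \<open>j\<close>. By cyclicity the trace equals
  \<open>tr (P W A\<^sub>1) - tr (W P A\<^sub>2)\<close>. In eigenbases of \<open>A\<^sub>1\<close> and \<open>A\<^sub>2\<close> its real part is the sum of the eigenvalues
  of \<open>A\<^sub>1 \<oplus> A\<^sub>2\<close> weighted by the real diagonal entries of \<open>P W\<close> and of \<open>- W P\<close>. The weights are bounded
  by \<open>1\<close>; they sum to \<open>0\<close> since \<open>P W\<close> and \<open>W P\<close> have the same trace; and their mass is at most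
  \<open>2 min j k\<close> since both products are contractions that factor through either truncation.\<close>

lemma trace_truncated_commutator_le_spread:
  assumes A: "A\<^sub>1 \<in> carrier_mat n n" "hermitian A\<^sub>1" "A\<^sub>2 \<in> carrier_mat n n" "hermitian A\<^sub>2"
    and contr: "contraction n P\<^sub>1" "contraction n P\<^sub>2" "contraction n W\<^sub>1" "contraction n W\<^sub>2"
    and jk: "j \<le> n" "k \<le> n"
  defines "P \<equiv> P\<^sub>1 * truncation n k * P\<^sub>2" and "W \<equiv> W\<^sub>1 * truncation n j * W\<^sub>2"
  shows "Re (mat_trace (P * (W * A\<^sub>1 - A\<^sub>2 * W)))
    \<le> (\<Sum>i<min j k. spectral_spread (direct_sum_mat A\<^sub>1 A\<^sub>2) ! i)"
proof -
  note sq = mult_assoc_square[where n = n] mult_closed_square[where n = n]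
    left_mult_one_mat[of _ n n] right_mult_one_mat[of _ n n]
  define E where "E k = truncation n k" for k
  have E: "E k \<in> carrier_mat n n" "contraction n (E k)" for k
    by (simp_all add: E_def contraction_truncation)
  note cc = contr[THEN contraction_carrier]
  have P: "P \<in> carrier_mat n n" "contraction n P" and W: "W \<in> carrier_mat n n" "contraction n W"
    using contr by (simp_all add: P_def W_def contraction_carrier contraction_mult contraction_truncation mult_closed_square)
  define a where "a = eigenvalue_list A\<^sub>1"
  define b where "b = eigenvalue_list A\<^sub>2"
  obtain G where G: "unitary n G" and A1: "A\<^sub>1 = G * mat_diag n (\<lambda>i. complex_of_real (a ! i)) * mat_adjoint G"
    using hermitian_eigenvalue_list(4)[OF A(1,2)] by (auto simp: a_def)
  obtain H where H: "unitary n H" and A2: "A\<^sub>2 = H * mat_diag n (\<lambda>i. complex_of_real (b ! i)) * mat_adjoint H"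
    using hermitian_eigenvalue_list(4)[OF A(3,4)] by (auto simp: b_def)
  have len: "length a = n" "length b = n"
    using hermitian_eigenvalue_list(1) A by (simp_all add: a_def b_def)
  \<comment> \<open>A trace against a diagonalised matrix only sees the diagonal in its eigenbasis.\<close>
  have half: "mat_trace (M * B) = (\<Sum>i<n. f i * (mat_adjoint U * M * U) $$ (i, i))
      \<and> mat_trace (mat_adjoint U * M * U) = mat_trace M"
    if U: "unitary n U" and B: "B = U * mat_diag n f * mat_adjoint U" and M: "M \<in> carrier_mat n n" for U B f M
  proof -
    define D where "D = mat_diag n f"
    have c: "U \<in> carrier_mat n n" "mat_adjoint U \<in> carrier_mat n n" "D \<in> carrier_mat n n"
      using U by (simp_all add: unitary_def D_def)
    have "mat_trace (M * B) = mat_trace ((M * U) * (D * mat_adjoint U))"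
      unfolding B D_def[symmetric] using c M by (simp add: sq)
    also have "\<dots> = mat_trace ((D * mat_adjoint U) * (M * U))"
      by (rule mat_trace_comm[of _ n n]) (use c M in \<open>simp_all add: sq\<close>)
    also have "\<dots> = mat_trace (D * (mat_adjoint U * M * U))" using c M by (simp add: sq)
    also have "\<dots> = (\<Sum>i<n. f i * (mat_adjoint U * M * U) $$ (i, i))"
      unfolding D_def by (rule mat_trace_diag_mult) (use c M in \<open>simp add: sq\<close>)
    finally have 1: "mat_trace (M * B) = \<dots>" .
    have "mat_trace (mat_adjoint U * M * U) = mat_trace (mat_adjoint U * (M * U))"
      using c M by (simp add: sq)
    also have "\<dots> = mat_trace ((M * U) * mat_adjoint U)"
      by (rule mat_trace_comm[of _ n n]) (use c M in \<open>simp_all add: sq\<close>)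
    also have "\<dots> = mat_trace (M * (U * mat_adjoint U))" using c M by (simp add: sq)
    also have "\<dots> = mat_trace M" using U M by (simp add: unitary_def)
    finally show ?thesis using 1 by simp
  qed
  \<comment> \<open>The unitary basis change is absorbed into the contractions on both sides of the truncation.\<close>
  have mass: "(\<Sum>i<n. cmod ((mat_adjoint U * (R * E k * S) * U) $$ (i, i))) \<le> real k"
    if U: "unitary n U" and RS: "contraction n R" "contraction n S" and k: "k \<le> n" for U R S k
  proof -
    have c: "U \<in> carrier_mat n n" "mat_adjoint U \<in> carrier_mat n n" "R \<in> carrier_mat n n" "S \<in> carrier_mat n n"
      using U RS by (simp_all add: unitary_def contraction_carrier)
    have "mat_adjoint U * (R * E k * S) * U = (mat_adjoint U * R) * E k * (S * U)"
      using c E by (simp add: sq)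
    then show ?thesis
      using sum_diag_truncated_le[of n "mat_adjoint U * R" "S * U" k] U RS k
      by (simp add: E_def contraction_mult contraction_unitary contraction_adjoint)
  qed
  define K where "K = mat_adjoint G * (P * W) * G"
  define L where "L = mat_adjoint H * (W * P) * H"
  have KL: "contraction n K" "contraction n L"
    using P W G H by (simp_all add: K_def L_def contraction_mult contraction_unitary contraction_adjoint)
  \<comment> \<open>Each product passes through both truncations, whence the minimum of \<open>j\<close> and \<open>k\<close>.\<close>
  have PWj: "P * W = (P * W\<^sub>1) * E j * W\<^sub>2" and PWk: "P * W = P\<^sub>1 * E k * (P\<^sub>2 * W)"
    and WPj: "W * P = W\<^sub>1 * E j * (W\<^sub>2 * P)" and WPk: "W * P = (W * P\<^sub>1) * E k * P\<^sub>2"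
    unfolding P_def W_def E_def[symmetric] using cc E by (simp_all add: sq)
  have K_mass: "(\<Sum>i<n. cmod (K $$ (i, i))) \<le> real (min j k)"
    using mass[OF G _ contr(4) jk(1), of "P * W\<^sub>1"] mass[OF G contr(1) _ jk(2), of "P\<^sub>2 * W"] P W contr
    unfolding K_def PWj[symmetric] PWk[symmetric] by (simp add: contraction_mult)
  have L_mass: "(\<Sum>i<n. cmod (L $$ (i, i))) \<le> real (min j k)"
    using mass[OF H contr(3) _ jk(1), of "W\<^sub>2 * P"] mass[OF H _ contr(2) jk(2), of "W * P\<^sub>1"] P W contr
    unfolding L_def WPj[symmetric] WPk[symmetric] by (simp add: contraction_mult)
  have PW: "P * W \<in> carrier_mat n n" "W * P \<in> carrier_mat n n" using P W by (simp_all add: sq)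
  have "mat_trace (P * (W * A\<^sub>1 - A\<^sub>2 * W)) = mat_trace (P * W * A\<^sub>1 - P * (A\<^sub>2 * W))"
    using P W A by (simp add: mult_minus_distrib_mat[of _ n n _ n] sq)
  also have "\<dots> = mat_trace (P * W * A\<^sub>1) - mat_trace (P * (A\<^sub>2 * W))"
    by (rule mat_trace_minus[of _ n]) (use P W A in \<open>simp_all add: sq\<close>)
  also have "mat_trace (P * (A\<^sub>2 * W)) = mat_trace ((P * A\<^sub>2) * W)"
    using P W A by (simp add: sq)
  also have "\<dots> = mat_trace (W * (P * A\<^sub>2))"
    by (rule mat_trace_comm[of _ n n]) (use P W A in \<open>simp_all add: sq\<close>)
  also have "\<dots> = mat_trace (W * P * A\<^sub>2)"
    using P W A by (simp add: sq)
  finally have trace: "mat_trace (P * (W * A\<^sub>1 - A\<^sub>2 * W))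
      = (\<Sum>i<n. complex_of_real (a ! i) * K $$ (i, i)) - (\<Sum>i<n. complex_of_real (b ! i) * L $$ (i, i))"
    using half[OF G A1 PW(1)] half[OF H A2 PW(2)] by (simp add: K_def L_def)
  have "mat_trace K = mat_trace L"
    using half[OF G A1 PW(1)] half[OF H A2 PW(2)] mat_trace_comm[OF P(1) W(1)] by (simp add: K_def L_def)
  then have trace_eq: "(\<Sum>i<n. Re (K $$ (i, i))) = (\<Sum>i<n. Re (L $$ (i, i)))"
    using KL[THEN contraction_carrier] by (auto simp: mat_trace_def dest: arg_cong[where f = Re])
  define d where "d = a @ b"
  define h where "h = map (\<lambda>i. Re (K $$ (i, i))) [0..<n] @ map (\<lambda>i. - Re (L $$ (i, i))) [0..<n]"
  define \<mu> where "\<mu> = eigenvalue_list (direct_sum_mat A\<^sub>1 A\<^sub>2)"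
  have \<mu>: "\<mu> = rev (sort d)"
    using direct_sum_eigenvalue_list[OF A] by (simp add: \<mu>_def d_def a_def b_def)
  have split: "(\<Sum>i<2 * n. F i) = (\<Sum>i<n. F i) + (\<Sum>i<n. F (n + i))" for F :: "nat \<Rightarrow> real"
    using sum.atLeastLessThan_concat[of 0 n "n + n" F] sum.shift_bounds_nat_ivl[of F 0 n n]
    by (simp add: lessThan_atLeast0 mult_2 add.commute)
  have "(\<Sum>i<2 * n. d ! i * h ! i) \<le> (\<Sum>i<min j k. \<mu> ! i - \<mu> ! (2 * n - 1 - i))"
  proof (rule balanced_weighted_sum_le)
    show "length d = 2 * n" "length h = 2 * n" using len by (simp_all add: d_def h_def)
    show "mset \<mu> = mset d" "sorted_wrt (\<ge>) \<mu>" by (simp_all add: \<mu> sorted_wrt_rev)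
    show "\<bar>h ! i\<bar> \<le> 1" if "i < 2 * n" for i
    proof (cases "i < n")
      case True
      then show ?thesis
        using contraction_entry[OF KL(1), of i i] abs_Re_le_cmod[of "K $$ (i, i)"] by (simp add: h_def nth_append)
    next
      case False
      then have "i - n < n" using that by simp
      then show ?thesis
        using contraction_entry[OF KL(2), of "i - n" "i - n"] abs_Re_le_cmod[of "L $$ (i - n, i - n)"] False
        by (simp add: h_def nth_append)
    qed
    show "(\<Sum>i<2 * n. h ! i) = 0"
      unfolding split using trace_eq by (simp add: h_def nth_append sum_negf)
    have "(\<Sum>i<2 * n. \<bar>h ! i\<bar>) = (\<Sum>i<n. \<bar>Re (K $$ (i, i))\<bar>) + (\<Sum>i<n. \<bar>Re (L $$ (i, i))\<bar>)"
      unfolding split by (simp add: h_def nth_append)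
    also have "\<dots> \<le> (\<Sum>i<n. cmod (K $$ (i, i))) + (\<Sum>i<n. cmod (L $$ (i, i)))"
      by (intro add_mono sum_mono abs_Re_le_cmod)
    finally show "(\<Sum>i<2 * n. \<bar>h ! i\<bar>) \<le> 2 * real (min j k)" using K_mass L_mass by simp
    show "2 * min j k \<le> 2 * n" using jk by simp
  qed
  also have "(\<Sum>i<2 * n. d ! i * h ! i) = Re (mat_trace (P * (W * A\<^sub>1 - A\<^sub>2 * W)))"
    unfolding split trace using len by (simp add: d_def h_def nth_append sum_negf)
  also have "(\<Sum>i<min j k. \<mu> ! i - \<mu> ! (2 * n - 1 - i))
      = (\<Sum>i<min j k. spectral_spread (direct_sum_mat A\<^sub>1 A\<^sub>2) ! i)"
    using jk A by (intro sum.cong) (auto simp: spectral_spread_def \<mu>_def direct_sum_mat_def mult_2)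
  finally show ?thesis .
qed

section \<open>The commutator inequality\<close>

text \<open>Summation by parts: nonnegative decreasing weights turn an inequality between partial sums into
  one between weighted sums.\<close>

lemma sum_mono_partial_sums:
  fixes s x y :: "nat \<Rightarrow> real"
  assumes s: "\<And>i. Suc i < n \<Longrightarrow> s (Suc i) \<le> s i" "\<And>i. i < n \<Longrightarrow> 0 \<le> s i"
    and partial: "\<And>k. k \<le> n \<Longrightarrow> (\<Sum>i<k. x i) \<le> (\<Sum>i<k. y i)"
  shows "(\<Sum>i<n. s i * x i) \<le> (\<Sum>i<n. s i * y i)"
proof -
  define z where "z i = y i - x i" for i
  have z: "0 \<le> (\<Sum>i<k. z i)" if "k \<le> n" for k
    using partial[OF that] by (simp add: z_def sum_subtractf)
  have ind: "s m * (\<Sum>i<Suc m. z i) \<le> (\<Sum>i<Suc m. s i * z i)" if "m < n" for m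
    using that
  proof (induct m)
    case (Suc m)
    have "s (Suc m) * (\<Sum>i<Suc m. z i) \<le> s m * (\<Sum>i<Suc m. z i)"
      using Suc(2) s(1) z[of "Suc m"] by (intro mult_right_mono) auto
    also have "\<dots> \<le> (\<Sum>i<Suc m. s i * z i)" using Suc by simp
    finally show ?case by (simp add: distrib_left)
  qed simp
  have "0 \<le> (\<Sum>i<n. s i * z i)"
  proof (cases n)
    case (Suc m)
    then have "0 \<le> s m * (\<Sum>i<Suc m. z i)" by (intro mult_nonneg_nonneg s(2) z) simp_all
    also have "\<dots> \<le> (\<Sum>i<Suc m. s i * z i)" using Suc by (intro ind) simp
    finally show ?thesis using Suc by simp
  qed simp
  then show ?thesis by (simp add: z_def right_diff_distrib sum_subtractf)
qed

lemma sorted_spectral_spread: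
  assumes A: "A \<in> carrier_mat m m" "hermitian A"
  shows "sorted_wrt (\<ge>) (spectral_spread A)" "\<forall>x \<in> set (spectral_spread A). 0 \<le> x"
    "length (spectral_spread A) = m div 2"
proof -
  note len = hermitian_eigenvalue_list(1)[OF A] and mono = sorted_ge_nth_mono[OF hermitian_eigenvalue_list(2)[OF A]]
  show "length (spectral_spread A) = m div 2" using A by (simp add: spectral_spread_def)
  show "sorted_wrt (\<ge>) (spectral_spread A)"
    unfolding sorted_wrt_iff_nth_less using A len
    by (auto simp: spectral_spread_def intro!: diff_mono mono)
  show "\<forall>x \<in> set (spectral_spread A). 0 \<le> x"
    using A len by (auto simp: spectral_spread_def intro!: mono)
qed

lemma decreasing_sorted: "sorted_wrt (\<ge>) xs \<Longrightarrow> decreasing xs = xs"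
  by (simp add: decreasing_def rev_sort_decreasing)

theorem theorem3p1:
  fixes n :: nat and A\<^sub>1 A\<^sub>2 X :: "complex mat"
  assumes "A\<^sub>1 \<in> carrier_mat n n" and "hermitian A\<^sub>1"
    and "A\<^sub>2 \<in> carrier_mat n n" and "hermitian A\<^sub>2"
    and "X \<in> carrier_mat n n"
  shows "singular_values (A\<^sub>1 * X - X * A\<^sub>2) \<prec>\<^sub>w
    map2 (*) (singular_values X) (spectral_spread (direct_sum_mat A\<^sub>1 A\<^sub>2))"
proof -
  note A = assms(1-4) and X = assms(5)
  note sq = mult_assoc_square[where n = n] mult_closed_square[where n = n]
    left_mult_one_mat[of _ n n] right_mult_one_mat[of _ n n]
  define C where "C = A\<^sub>1 * X - X * A\<^sub>2"
  have C: "C \<in> carrier_mat n n" using A X by (simp add: C_def sq minus_carrier_mat)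
  define s where "s = singular_values X"
  define t where "t = singular_values C"
  define \<sigma> where "\<sigma> = spectral_spread (direct_sum_mat A\<^sub>1 A\<^sub>2)"
  define S where "S = mat_diag n (\<lambda>i. complex_of_real (s ! i))"
  define T where "T = mat_diag n (\<lambda>i. complex_of_real (t ! i))"
  note svdX = singular_value_decomposition[OF X, folded s_def, folded S_def]
  note svdC = singular_value_decomposition[OF C, folded t_def, folded T_def]
  obtain Y Z where YZ: "contraction n Y" "unitary n Z" "X = Y * S * mat_adjoint Z"
    using svdX(4) by blast
  obtain U V where UV: "contraction n U" "unitary n V" "mat_adjoint U * C * V = T"
    using svdC(4) by blast
  have S: "S \<in> carrier_mat n n" by (simp add: S_def)
  have c: "Y \<in> carrier_mat n n" "Z \<in> carrier_mat n n" "U \<in> carrier_mat n n" "V \<in> carrier_mat n n"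
    "mat_adjoint Z \<in> carrier_mat n n" "mat_adjoint U \<in> carrier_mat n n"
    using YZ UV by (simp_all add: contraction_carrier unitary_carrier)
  have contr: "contraction n (mat_adjoint Z)" "contraction n V" "contraction n (mat_adjoint U)"
    using YZ UV by (simp_all add: contraction_unitary contraction_adjoint)
  have "direct_sum_mat A\<^sub>1 A\<^sub>2 \<in> carrier_mat (n + n) (n + n)"
    using A by (auto simp: direct_sum_mat_def)
  moreover have "hermitian (direct_sum_mat A\<^sub>1 A\<^sub>2)"
    using mat_adjoint_four_block_diag[OF A(1,3)] A by (simp add: hermitian_def direct_sum_mat_def)
  ultimately have \<sigma>: "sorted_wrt (\<ge>) \<sigma>" "\<forall>x \<in> set \<sigma>. 0 \<le> x" "length \<sigma> = n"
    using sorted_spectral_spread[of "direct_sum_mat A\<^sub>1 A\<^sub>2" "n + n"] by (simp_all add: \<sigma>_def)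
  define y where "y = map2 (*) s \<sigma>"
  have leny: "length y = n" using \<sigma>(3) svdX(1) by (simp add: y_def)
  have "sorted_wrt (\<ge>) y"
    unfolding sorted_wrt_iff_nth_less
  proof (intro allI impI)
    fix i j assume ij: "i < j" "j < length y"
    then have "s ! j * \<sigma> ! j \<le> s ! i * \<sigma> ! i"
      using svdX \<sigma> leny by (intro mult_mono sorted_ge_nth_mono) auto
    then show "y ! i \<ge> y ! j" using ij \<sigma>(3) svdX(1) leny by (simp add: y_def)
  qed
  then have decy: "decreasing y = y" by (rule decreasing_sorted)
  have dect: "decreasing t = t" using svdC(2) by (rule decreasing_sorted)
  have main: "(\<Sum>i<j. t ! i) \<le> (\<Sum>i<j. y ! i)" if j: "j \<le> n" for j
  proof -
    \<comment> \<open>The contraction of rank at most \<open>j\<close> that attains the sum of the \<open>j\<close> largest singular values of \<open>C\<close>.\<close>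
    define W where "W = V * truncation n j * mat_adjoint U"
    have W: "W \<in> carrier_mat n n" using c by (simp add: W_def sq)
    define M where "M = W * A\<^sub>1 - A\<^sub>2 * W"
    have M: "M \<in> carrier_mat n n" using W A by (simp add: M_def sq minus_carrier_mat)
    define l where "l b = Re ((mat_adjoint Z * M * Y) $$ (b, b))" for b
    have ZMY: "mat_adjoint Z * M * Y \<in> carrier_mat n n" using c M by (simp add: sq)
    have "(\<Sum>i<j. complex_of_real (t ! i)) = mat_trace (truncation n j * (mat_adjoint U * C * V))"
      unfolding UV(3) using j by (subst mat_trace_truncation_mult) (auto simp: T_def mat_diag_def)
    also have "\<dots> = mat_trace ((truncation n j * mat_adjoint U) * (C * V))"
      using c C by (simp add: sq)
    also have "\<dots> = mat_trace ((C * V) * (truncation n j * mat_adjoint U))"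
      by (rule mat_trace_comm[of _ n n]) (use c C in \<open>simp_all add: sq\<close>)
    also have "\<dots> = mat_trace (C * W)"
      unfolding W_def using c C by (simp add: sq)
    also have "\<dots> = mat_trace (A\<^sub>1 * (X * W) - X * (A\<^sub>2 * W))"
      unfolding C_def using A X W by (simp add: minus_mult_distrib_mat[of _ n n _ _ n] sq)
    also have "\<dots> = mat_trace (A\<^sub>1 * (X * W)) - mat_trace (X * (A\<^sub>2 * W))"
      by (rule mat_trace_minus[of _ n]) (use A X W in \<open>simp_all add: sq\<close>)
    also have "mat_trace (A\<^sub>1 * (X * W)) = mat_trace ((X * W) * A\<^sub>1)"
      by (rule mat_trace_comm[of _ n n]) (use A X W in \<open>simp_all add: sq\<close>)
    also have "mat_trace ((X * W) * A\<^sub>1) - mat_trace (X * (A\<^sub>2 * W)) = mat_trace ((X * W) * A\<^sub>1 - X * (A\<^sub>2 * W))"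
      by (rule mat_trace_minus[of _ n, symmetric]) (use A X W in \<open>simp_all add: sq\<close>)
    also have "\<dots> = mat_trace (X * M)"
      unfolding M_def using A X W by (simp add: mult_minus_distrib_mat[of _ n n _ n] sq)
    also have "\<dots> = mat_trace (Y * (S * mat_adjoint Z * M))"
      unfolding YZ(3) using c S M by (simp add: sq)
    also have "\<dots> = mat_trace ((S * mat_adjoint Z * M) * Y)"
      by (rule mat_trace_comm[of _ n n]) (use c S M in \<open>simp_all add: sq\<close>)
    also have "\<dots> = mat_trace (S * (mat_adjoint Z * M * Y))"
      using c S M by (simp add: sq)
    also have "\<dots> = (\<Sum>b<n. complex_of_real (s ! b) * (mat_adjoint Z * M * Y) $$ (b, b))"
      unfolding S_def by (rule mat_trace_diag_mult[OF ZMY])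
    finally have "Re (\<Sum>i<j. complex_of_real (t ! i))
        = Re (\<Sum>b<n. complex_of_real (s ! b) * (mat_adjoint Z * M * Y) $$ (b, b))" by simp
    then have "(\<Sum>i<j. t ! i) = (\<Sum>b<n. s ! b * l b)"
      by (simp add: l_def)
    also have "\<dots> \<le> (\<Sum>b<n. s ! b * (if b < j then \<sigma> ! b else 0))"
    proof (rule sum_mono_partial_sums)
      show "s ! Suc i \<le> s ! i" if "Suc i < n" for i
        using sorted_ge_nth_mono[OF svdX(2)] svdX(1) that by simp
      show "0 \<le> s ! i" if "i < n" for i using svdX(1,3) that by simp
      fix k assume k: "k \<le> n"
      \<comment> \<open>A partial sum over \<open>b\<close> replaces the singular values of \<open>X\<close> by \<open>k\<close> ones followed by zeros.\<close>
      define P where "P = Y * truncation n k * mat_adjoint Z"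
      have "(\<Sum>b<k. (mat_adjoint Z * M * Y) $$ (b, b)) = mat_trace (truncation n k * (mat_adjoint Z * M * Y))"
        by (rule mat_trace_truncation_mult[OF ZMY k, symmetric])
      also have "\<dots> = mat_trace ((truncation n k * mat_adjoint Z * M) * Y)"
        using c M by (simp add: sq)
      also have "\<dots> = mat_trace (Y * (truncation n k * mat_adjoint Z * M))"
        by (rule mat_trace_comm[of _ n n]) (use c M in \<open>simp_all add: sq\<close>)
      also have "\<dots> = mat_trace (P * M)"
        unfolding P_def using c M by (simp add: sq)
      finally have "(\<Sum>b<k. l b) = Re (mat_trace (P * M))"
        by (simp add: l_def flip: Re_sum)
      also have "\<dots> \<le> (\<Sum>i<min j k. \<sigma> ! i)"
        unfolding P_def M_def W_def \<sigma>_def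
        by (rule trace_truncated_commutator_le_spread[OF A YZ(1) contr j k])
      also have "\<dots> = (\<Sum>b<k. if b < j then \<sigma> ! b else 0)"
        by (intro sum.mono_neutral_cong_left) auto
      finally show "(\<Sum>b<k. l b) \<le> (\<Sum>b<k. if b < j then \<sigma> ! b else 0)" .
    qed
    also have "\<dots> = (\<Sum>b<j. y ! b)"
      using j \<sigma>(3) svdX(1) by (intro sum.mono_neutral_cong_right) (auto simp: y_def)
    finally show ?thesis .
  qed
  show ?thesis
    unfolding submajorized_def C_def[symmetric] t_def[symmetric] s_def[symmetric] \<sigma>_def[symmetric] y_def[symmetric]
      decy dect
    using main leny svdC(1) by simp
qed

end
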